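(* Let $m$ be a focus-focus point, with eigenvalues $\pm\alpha\pm\mathrm{i}\omega$ ($\alpha,\omega\ne0$), of a Liouville integrable Hamiltonian system with two degrees of freedom. On the regular tori close to the focus-focus singular fibre, labelled by the value $j\in\mathbb{R}^2\setminus\{0\}$ of the momentum map $J$, the Jacobian determinant of the frequency map $I=(I_1,I_2)\mapsto\omega(I)=(\omega_1,\omega_2)$ admits, as $j\to0$, the asymptotic expansion $$\det\frac{\partial\omega}{\partial I}=-\left(\frac{2\pi\alpha}{|j|\,\tau_1^2}\right)^2+O\!\left(\frac{1}{|j|\,\tau_1^3}\right),$$ where $\tau_1=\tau_1(j)$ is of order $\ln|j|$. In particular the Kolmogorov condition $\det\,\partial\omega/\partial I\neq0$ is satisfied for every regular torus sufficiently near the singular fibre.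
   Context: Setting. All objects are $C^\infty$. $(M,\Omega)$ is a four-dimensional symplectic manifold, $H,L$ are commuting functions, $F=(H,L)$ is regular almost everywhere, $m$ is an equilibrium of $H$ with $F(m)=(0,0)$ whose linearization has eigenvalues $\pm\alpha\pm\mathrm{i}\omega$, $\alpha,\omega\ne0$; the component of $F^{-1}(0,0)$ containing $m$ (the singular fibre) is compact and contains no other critical point of $F$. There are symplectic coordinates near $m$ in which $H=\Phi\circ J$, $L=\Psi\circ J$, where $J=(J_1,J_2)$, $J_1=xp_x+yp_y$, $J_2=xp_y-yp_x$, $\Omega=dx\wedge dp_x+dy\wedge dp_y$, $(\Phi,\Psi)$ is a local diffeomorphism of $\mathbb{R}^2$ at $0$, $\Phi(0)=0$, $\partial_1\Phi(0)=\alpha$, $\partial_2\Phi(0)=\omega$. Hamiltonian vector fields are $\dot x=\partial H/\partial p_x$, $\dot p_x=-\partial H/\partial x$, etc. $J$ is extended to a neighbourhood of the singular fibre by $J=(\Phi,\Psi)^{-1}\circ(H,L)$. For $j\neq0$ small, the fibre of $J$ over $j$ near the singular fibre is a regular torus. Known facts, part of the setting: the flow of $J_2$ is $2\pi$-periodic near the singular fibre, so $I_2:=J_2$ is an action; a second action $I_1$ (with $2\pi$-periodic flow, $(I_1,I_2)$ action variables, regarded as functions of $j$) satisfies $2\pi\mathcal{X}_{I_1}=\tau_1\mathcal{X}_{J_1}+\tau_2\mathcal{X}_{J_2}$, i.e. $2\pi\,\partial I_1/\partial j_i=\tau_i$, with $$\tau_1(j)=\sigma_1(j)-\mathrm{Re}(\ln\zeta),\qquad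 \tau_2(j)=\sigma_2(j)+\mathrm{Im}(\ln\zeta),\qquad \zeta=j_1+\mathrm{i}j_2,$$ where $\sigma_1,\sigma_2$ are smooth single-valued functions near the origin. $I_1$ and $\tau_2$ depend on a local choice of branch of $\ln\zeta$; the determinant above does not depend on this choice. Frequencies: $\mathcal{X}_H=\omega_1\mathcal{X}_{I_1}+\omega_2\mathcal{X}_{I_2}$, i.e. $\omega_i=\partial H/\partial I_i$. (The number $\omega$ in the eigenvalue is not to be confused with the frequency vector $\omega(I)$.) *)

theory Defs
  imports "HOL-Analysis.Analysis" "HOL-Library.Landau_Symbols"
begin

section \<open>Smooth maps between Euclidean spaces\<close>

text \<open>These notions are only used on open sets.\<close>

fun Ck_on :: "nat \<Rightarrow> 'a::real_normed_vector set \<Rightarrow> ('a \<Rightarrow> 'b::real_normed_vector) \<Rightarrow> bool" where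
  "Ck_on 0 S f \<longleftrightarrow> continuous_on S f"
| "Ck_on (Suc k) S f \<longleftrightarrow> (\<forall>x\<in>S. f differentiable (at x)) \<and>
     (\<forall>v. Ck_on k S (\<lambda>x. frechet_derivative f (at x) v))"

definition smooth_on :: "'a::real_normed_vector set \<Rightarrow> ('a \<Rightarrow> 'b::real_normed_vector) \<Rightarrow> bool" where
  "smooth_on S f \<longleftrightarrow> (\<forall>k. Ck_on k S f)"

definition diffeo_on :: "'a::real_normed_vector set \<Rightarrow> ('a \<Rightarrow> 'b::real_normed_vector) \<Rightarrow> bool" where
  "diffeo_on S f \<longleftrightarrow> open S \<and> open (f ` S) \<and> inj_on f S \<and>
     smooth_on S f \<and> smooth_on (f ` S) (inv_into S f)"

definition pair_map :: "('a \<Rightarrow> real) \<Rightarrow> ('a \<Rightarrow> real) \<Rightarrow> 'a \<Rightarrow> real^2" where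
  "pair_map f g = (\<lambda>x. vector [f x, g x])"

definition is_eigenvalue :: "(real^'n \<Rightarrow> real^'n) \<Rightarrow> complex \<Rightarrow> bool" where
  "is_eigenvalue T z \<longleftrightarrow>
     (\<exists>v::complex^'n. v \<noteq> 0 \<and> (\<chi> i j. complex_of_real (matrix T $ i $ j)) *v v = z *s v)"


section \<open>Four-dimensional symplectic manifolds\<close>

text \<open>A chart is an open set together with a coordinate map, whose values outside that set are
  irrelevant.  The Hausdorff and countability axioms are expressed by the type classes
  \<open>t2_space\<close> and \<open>second_countable_topology\<close> of the type of points.\<close>

type_synonym 'm chart = "'m set \<times> ('m \<Rightarrow> real^4)"

definition param :: "'m chart \<Rightarrow> real^4 \<Rightarrow> 'm" where
  "param c = inv_into (fst c) (snd c)"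

definition is_chart :: "'m::topological_space chart \<Rightarrow> bool" where
  "is_chart c \<longleftrightarrow> open (fst c) \<and> open (snd c ` fst c) \<and>
     homeomorphism (fst c) (snd c ` fst c) (snd c) (param c)"

definition compatible :: "'m chart \<Rightarrow> 'm chart \<Rightarrow> bool" where
  "compatible c d \<longleftrightarrow>
     smooth_on (snd c ` (fst c \<inter> fst d)) (snd d \<circ> param c) \<and>
     smooth_on (snd d ` (fst c \<inter> fst d)) (snd c \<circ> param d)"

definition smooth_structure ::
    "'m::{t2_space,second_countable_topology} set \<Rightarrow> 'm chart set \<Rightarrow> bool" where
  "smooth_structure M A \<longleftrightarrow>
     M = (\<Union>c\<in>A. fst c) \<and> (\<forall>c\<in>A. is_chart c) \<and> (\<forall>c\<in>A. \<forall>d\<in>A. compatible c d) \<and>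
     (\<forall>c. is_chart c \<and> fst c \<subseteq> M \<and> (\<forall>d\<in>A. compatible c d) \<longrightarrow> c \<in> A)"

definition smooth_function :: "'m chart set \<Rightarrow> 'm set \<Rightarrow> ('m \<Rightarrow> real) \<Rightarrow> bool" where
  "smooth_function A N f \<longleftrightarrow> (\<forall>c\<in>A. smooth_on (snd c ` (fst c \<inter> N)) (f \<circ> param c))"

definition differential :: "('m \<Rightarrow> real) \<Rightarrow> 'm chart \<Rightarrow> 'm \<Rightarrow> real^4 \<Rightarrow> real" where
  "differential f c p = frechet_derivative (f \<circ> param c) (at (snd c p))"

text \<open>A 2-form is given by its coordinate representations: \<open>\<Omega> c x\<close> is the bilinear form
  at the point with coordinates \<open>x\<close> in the chart \<open>c\<close>.  The conjuncts are: pointwise bilinearity,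
  alternation and nondegeneracy; smoothness; closedness (\<open>d\<Omega>\<close> evaluated on constant vector
  fields); invariance under change of charts.\<close>

type_synonym 'm two_form = "'m chart \<Rightarrow> real^4 \<Rightarrow> real^4 \<Rightarrow> real^4 \<Rightarrow> real"

definition symplectic_form :: "'m chart set \<Rightarrow> 'm two_form \<Rightarrow> bool" where
  "symplectic_form A \<Omega> \<longleftrightarrow>
     (\<forall>c\<in>A. \<forall>x\<in>snd c ` fst c. bilinear (\<Omega> c x) \<and> (\<forall>v. \<Omega> c x v v = 0) \<and>
        (\<forall>v. (\<forall>w. \<Omega> c x v w = 0) \<longrightarrow> v = 0)) \<and>
     (\<forall>c\<in>A. \<forall>v w. smooth_on (snd c ` fst c) (\<lambda>x. \<Omega> c x v w)) \<and>
     (\<forall>c\<in>A. \<forall>x\<in>snd c ` fst c. \<forall>u v w.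
        frechet_derivative (\<lambda>y. \<Omega> c y v w) (at x) u +
        frechet_derivative (\<lambda>y. \<Omega> c y w u) (at x) v +
        frechet_derivative (\<lambda>y. \<Omega> c y u v) (at x) w = 0) \<and>
     (\<forall>c\<in>A. \<forall>d\<in>A. \<forall>p\<in>fst c \<inter> fst d. \<forall>v w.
        \<Omega> c (snd c p) v w =
        \<Omega> d (snd d p) (frechet_derivative (snd d \<circ> param c) (at (snd c p)) v)
                     (frechet_derivative (snd d \<circ> param c) (at (snd c p)) w))"

text \<open>\<open>ham_vf \<Omega> f c p\<close> is the coordinate vector, in the chart \<open>c\<close>, of the Hamiltonian vector
  field of \<open>f\<close> at \<open>p\<close>.  With \<open>\<Omega> = dx \<and> dp\<^sub>x + dy \<and> dp\<^sub>y\<close> the sign convention below gives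
  \<open>x' = \<partial>f/\<partial>p\<^sub>x\<close>, \<open>p\<^sub>x' = - \<partial>f/\<partial>x\<close>, and likewise for \<open>y\<close>.\<close>

definition ham_vf :: "'m two_form \<Rightarrow> ('m \<Rightarrow> real) \<Rightarrow> 'm chart \<Rightarrow> 'm \<Rightarrow> real^4" where
  "ham_vf \<Omega> f c p = (THE v. \<forall>w. \<Omega> c (snd c p) v w = differential f c p w)"

definition commuting :: "'m chart set \<Rightarrow> 'm two_form \<Rightarrow> ('m \<Rightarrow> real) \<Rightarrow> ('m \<Rightarrow> real) \<Rightarrow> bool" where
  "commuting A \<Omega> f g \<longleftrightarrow>
     (\<forall>c\<in>A. \<forall>p\<in>fst c. \<Omega> c (snd c p) (ham_vf \<Omega> f c p) (ham_vf \<Omega> g c p) = 0)"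

definition regular_at :: "'m chart set \<Rightarrow> ('m \<Rightarrow> real^2) \<Rightarrow> 'm \<Rightarrow> bool" where
  "regular_at A F p \<longleftrightarrow> (\<forall>c\<in>A. p \<in> fst c \<longrightarrow>
     (\<forall>a b. (\<forall>w. a * differential (\<lambda>q. F q $ 1) c p w + b * differential (\<lambda>q. F q $ 2) c p w = 0)
        \<longrightarrow> a = 0 \<and> b = 0))"

definition regular_ae :: "'m chart set \<Rightarrow> ('m \<Rightarrow> real^2) \<Rightarrow> bool" where
  "regular_ae A F \<longleftrightarrow> (\<forall>c\<in>A. negligible (snd c ` {p \<in> fst c. \<not> regular_at A F p}))"

definition integral_curve ::
    "'m::topological_space chart set \<Rightarrow> 'm two_form \<Rightarrow> 'm set \<Rightarrow> ('m \<Rightarrow> real) \<Rightarrow> (real \<Rightarrow> 'm) \<Rightarrow> bool" where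
  "integral_curve A \<Omega> N f \<gamma> \<longleftrightarrow> (\<forall>t. \<gamma> t \<in> N) \<and> continuous_on UNIV \<gamma> \<and>
     (\<forall>t. \<forall>c\<in>A. \<gamma> t \<in> fst c \<longrightarrow>
        ((snd c \<circ> \<gamma>) has_vector_derivative ham_vf \<Omega> f c (\<gamma> t)) (at t))"


section \<open>The local model of a focus-focus point\<close>

text \<open>The coordinates \<open>(x, y, p\<^sub>x, p\<^sub>y)\<close> are the components 1, 2, 3, 4.\<close>

definition std_form :: "real^4 \<Rightarrow> real^4 \<Rightarrow> real" where
  "std_form v w = (v$1 * w$3 - v$3 * w$1) + (v$2 * w$4 - v$4 * w$2)"

definition std_momentum :: "real^4 \<Rightarrow> real^2" where
  "std_momentum v = vector [v$1 * v$3 + v$2 * v$4, v$1 * v$4 - v$2 * v$3]"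


section \<open>Actions and frequencies\<close>

definition zeta :: "real^2 \<Rightarrow> complex" where
  "zeta j = Complex (j$1) (j$2)"

text \<open>The real part of the logarithm is the same for all branches, so the principal one is used.\<close>

definition tau1 :: "(real^2 \<Rightarrow> real) \<Rightarrow> real^2 \<Rightarrow> real" where
  "tau1 \<sigma>1 j = \<sigma>1 j - Re (Ln (zeta j))"

definition tau2 :: "(real^2 \<Rightarrow> real) \<Rightarrow> (complex \<Rightarrow> complex) \<Rightarrow> real^2 \<Rightarrow> real" where
  "tau2 \<sigma>2 lg j = \<sigma>2 j + Im (lg (zeta j))"

definition log_branch :: "complex set \<Rightarrow> (complex \<Rightarrow> complex) \<Rightarrow> bool" where
  "log_branch Z lg \<longleftrightarrow> continuous_on Z lg \<and> (\<forall>z\<in>Z. exp (lg z) = z)"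

text \<open>\<open>I\<close> is a system of action variables, as functions of \<open>j \<in> U\<close>: a local coordinate system on
  the \<open>j\<close>-plane such that on the corresponding fibres of \<open>J\<close> in \<open>W\<close> the joint flow of
  \<open>I\<^sub>1 \<circ> J\<close>, \<open>I\<^sub>2 \<circ> J\<close> has period lattice \<open>(2\<pi>\<int>)\<^sup>2\<close>.  The joint flow with times
  \<open>(s\<^sub>1, s\<^sub>2)\<close> is the time-one flow of \<open>s\<^sub>1 I\<^sub>1 + s\<^sub>2 I\<^sub>2\<close>.\<close>

definition action_variables ::
    "'m::topological_space chart set \<Rightarrow> 'm two_form \<Rightarrow> 'm set \<Rightarrow> ('m \<Rightarrow> real^2) \<Rightarrow>
     (real^2) set \<Rightarrow> (real^2 \<Rightarrow> real^2) \<Rightarrow> bool" where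
  "action_variables A \<Omega> W J U I \<longleftrightarrow> diffeo_on U I \<and>
     (\<forall>p\<in>W. J p \<in> U \<longrightarrow> (\<forall>s::real^2. \<exists>\<gamma>.
        integral_curve A \<Omega> {q\<in>W. J q \<in> U} (\<lambda>q. s \<bullet> I (J q)) \<gamma> \<and> \<gamma> 0 = p \<and>
        (\<gamma> 1 = p \<longleftrightarrow> (\<exists>k1 k2 :: int. s = vector [2 * pi * k1, 2 * pi * k2]))))"

text \<open>\<open>I1\<close> is a first action on \<open>U\<close>, complementing \<open>I\<^sub>2 = j\<^sub>2\<close>, for the branch \<open>lg\<close> of the
  logarithm.\<close>

definition first_action ::
    "'m::topological_space chart set \<Rightarrow> 'm two_form \<Rightarrow> 'm set \<Rightarrow> ('m \<Rightarrow> real^2) \<Rightarrow>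
     (real^2 \<Rightarrow> real) \<Rightarrow> (real^2 \<Rightarrow> real) \<Rightarrow>
     (real^2) set \<Rightarrow> (complex \<Rightarrow> complex) \<Rightarrow> (real^2 \<Rightarrow> real) \<Rightarrow> bool" where
  "first_action A \<Omega> W J \<sigma>1 \<sigma>2 U lg I1 \<longleftrightarrow>
     open U \<and> 0 \<notin> U \<and> log_branch (zeta ` U) lg \<and>
     action_variables A \<Omega> W J U (pair_map I1 (\<lambda>j. j$2)) \<and>
     (\<forall>p\<in>W. J p \<in> U \<longrightarrow> (\<forall>c\<in>A. p \<in> fst c \<longrightarrow>
        (2 * pi) *\<^sub>R ham_vf \<Omega> (\<lambda>q. I1 (J q)) c p =
          tau1 \<sigma>1 (J p) *\<^sub>R ham_vf \<Omega> (\<lambda>q. J q $ 1) c p +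
          tau2 \<sigma>2 lg (J p) *\<^sub>R ham_vf \<Omega> (\<lambda>q. J q $ 2) c p))"

text \<open>\<open>\<omega>\<close> is a function of the actions, i.e. its argument ranges over \<open>I ` U\<close>.\<close>

definition frequency_map ::
    "'m chart set \<Rightarrow> 'm two_form \<Rightarrow> 'm set \<Rightarrow> ('m \<Rightarrow> real^2) \<Rightarrow> ('m \<Rightarrow> real) \<Rightarrow>
     (real^2) set \<Rightarrow> (real^2 \<Rightarrow> real^2) \<Rightarrow> (real^2 \<Rightarrow> real^2) \<Rightarrow> bool" where
  "frequency_map A \<Omega> W J H U I \<omega> \<longleftrightarrow>
     (\<forall>p\<in>W. J p \<in> U \<longrightarrow> (\<forall>c\<in>A. p \<in> fst c \<longrightarrow>
        ham_vf \<Omega> H c p =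
          (\<omega> (I (J p)) $ 1) *\<^sub>R ham_vf \<Omega> (\<lambda>q. I (J q) $ 1) c p +
          (\<omega> (I (J p)) $ 2) *\<^sub>R ham_vf \<Omega> (\<lambda>q. I (J q) $ 2) c p))"

text \<open>\<open>d\<close> is the determinant of \<open>\<partial>\<omega>/\<partial>I\<close> on the torus over \<open>j\<close>: the frequency map exists, and it
  is differentiable at \<open>I j\<close> with Jacobian determinant \<open>d\<close>.\<close>

definition frequency_jacobian ::
    "'m chart set \<Rightarrow> 'm two_form \<Rightarrow> 'm set \<Rightarrow> ('m \<Rightarrow> real^2) \<Rightarrow> ('m \<Rightarrow> real) \<Rightarrow>
     (real^2) set \<Rightarrow> (real^2 \<Rightarrow> real^2) \<Rightarrow> real^2 \<Rightarrow> real \<Rightarrow> bool" where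
  "frequency_jacobian A \<Omega> W J H U I j d \<longleftrightarrow>
     (\<exists>\<omega>. frequency_map A \<Omega> W J H U I \<omega>) \<and>
     (\<forall>\<omega>. frequency_map A \<Omega> W J H U I \<omega> \<longrightarrow>
        \<omega> differentiable (at (I j)) \<and>
        det (matrix (frechet_derivative \<omega> (at (I j)))) = d)"

end

theory Submission
  imports Defs
begin

text \<open>
  The chain rule for Hamiltonian vector fields gives
  \<open>X\<^sub>H = \<Phi>\<^sub>1 X\<^bsub>J\<^sub>1\<^esub> + \<Phi>\<^sub>2 X\<^bsub>J\<^sub>2\<^esub>\<close>, where the subscripts of \<open>\<Phi>\<close> denote partial derivatives.
  On a regular torus \<open>X\<^bsub>J\<^sub>1\<^esub>\<close> and \<open>X\<^bsub>J\<^sub>2\<^esub>\<close> are independent, so comparing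
  coefficients forces \<open>\<omega>\<^sub>1 = 2 \<pi> \<Phi>\<^sub>1 / \<tau>\<^sub>1\<close> and \<open>\<omega>\<^sub>2 = \<Phi>\<^sub>2 - \<Phi>\<^sub>1 \<tau>\<^sub>2 / \<tau>\<^sub>1\<close> as functions of \<open>j\<close>.
  Then \<open>det \<partial>\<omega>/\<partial>I = (2 \<pi> / \<tau>\<^sub>1) det \<partial>\<omega>/\<partial>j\<close>.  The terms with an undifferentiated \<open>\<tau>\<^sub>2\<close> cancel,
  which makes the result independent of the branch of the logarithm.  The singular parts of
  \<open>\<nabla>\<tau>\<^sub>1\<close> and \<open>\<nabla>\<tau>\<^sub>2\<close> are \<open>- j / |j|\<^sup>2\<close> and its rotation by a right angle; their product
  contributes \<open>- (2 \<pi> \<Phi>\<^sub>1)\<^sup>2 / (|j|\<^sup>2 \<tau>\<^sub>1\<^sup>4)\<close>, and everything else is of lower order because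
  \<open>\<tau>\<^sub>1 |j|\<close> tends to \<open>0\<close>.
\<close>


section \<open>The explicit Jacobian determinant\<close>

text \<open>\<open>P\<close>, \<open>dP\<close>, \<open>dQ\<close>, \<open>a\<close>, \<open>b\<close> stand for \<open>\<Phi>\<^sub>1\<close>, \<open>\<nabla>\<Phi>\<^sub>1\<close>, \<open>\<nabla>\<Phi>\<^sub>2\<close>, \<open>\<nabla>\<sigma>\<^sub>1\<close>, \<open>\<nabla>\<sigma>\<^sub>2\<close> at \<open>j\<close>.\<close>

definition jacobian_formula ::
    "real \<Rightarrow> real^2 \<Rightarrow> real \<Rightarrow> real^2 \<Rightarrow> real^2 \<Rightarrow> real^2 \<Rightarrow> real^2 \<Rightarrow> real" where
  "jacobian_formula \<tau> j P dP dQ a b = (2 * pi)\<^sup>2 / \<tau> *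
     ((dP$1 / \<tau> - P * (a$1 - j$1 / (norm j)\<^sup>2) / \<tau>\<^sup>2) * (dQ$2 - P / \<tau> * (b$2 + j$1 / (norm j)\<^sup>2)) -
      (dP$2 / \<tau> - P * (a$2 - j$2 / (norm j)\<^sup>2) / \<tau>\<^sup>2) * (dQ$1 - P / \<tau> * (b$1 - j$2 / (norm j)\<^sup>2)))"

lemma norm_vec2_squared: "(norm (j::real^2))\<^sup>2 = (j$1)\<^sup>2 + (j$2)\<^sup>2"
  by (simp add: norm_vec_def L2_set_def sum_2)

text \<open>The determinant is sorted by powers of \<open>s = 1 / \<tau>\<close> and
  \<open>t = 1 / norm j\<close>. Here \<open>(u, v)\<close> is the unit vector along
  \<open>j\<close>, and \<open>A1\<close>, \<open>A2\<close>, \<open>D1\<close>, \<open>D2\<close>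
  collect the parts that stay bounded. The two singular parts meet only in the coefficient of
  \<open>s^4 * t\<^sup>2\<close>, where \<open>u\<^sup>2 + v\<^sup>2 = 1\<close> reduces them to
  \<open>- P\<^sup>2\<close>; subtracting the leading term leaves
  \<open>\<alpha>\<^sup>2 - P\<^sup>2\<close> there.\<close>

lemma jacobian_formula_expand:
  fixes j dP dQ a b :: "real^2" and \<tau> P \<alpha> :: real
  assumes "j \<noteq> 0"
  defines "s \<equiv> 1 / \<tau>" and "t \<equiv> 1 / norm j" and "u \<equiv> j$1 / norm j" and "v \<equiv> j$2 / norm j"
  defines "A1 \<equiv> dP$1 - s * P * a$1" and "A2 \<equiv> dP$2 - s * P * a$2"
    and "D1 \<equiv> dQ$1 - s * P * b$1" and "D2 \<equiv> dQ$2 - s * P * b$2"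
  shows "jacobian_formula \<tau> j P dP dQ a b - (- ((2 * pi * \<alpha> / (norm j * \<tau>\<^sup>2))\<^sup>2)) =
    (2 * pi)\<^sup>2 * (s\<^sup>2 * (A1 * D2 - A2 * D1) + s^3 * t * (P * (u * (D2 - A1) - v * (D1 + A2))) +
                s^4 * t\<^sup>2 * (\<alpha>\<^sup>2 - P\<^sup>2))"
proof -
  have uv: "u\<^sup>2 + v\<^sup>2 = 1"
    using assms(1) by (simp add: u_def v_def power_divide norm_vec2_squared[symmetric] flip: add_divide_distrib)
  have x: "j$1 / (norm j)\<^sup>2 = t * u" "j$2 / (norm j)\<^sup>2 = t * v"
    by (simp_all add: t_def u_def v_def power2_eq_square)
  have "jacobian_formula \<tau> j P dP dQ a b = (2 * pi)\<^sup>2 * s *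
     ((s * A1 + s\<^sup>2 * P * t * u) * (D2 - s * P * t * u) - (s * A2 + s\<^sup>2 * P * t * v) * (D1 + s * P * t * v))"
    unfolding jacobian_formula_def x A1_def A2_def D1_def D2_def s_def
    by (simp add: divide_inverse algebra_simps power2_eq_square)
  also have "\<dots> = (2 * pi)\<^sup>2 * (s\<^sup>2 * (A1 * D2 - A2 * D1) + s^3 * t * (P * (u * (D2 - A1) - v * (D1 + A2)))
     - s^4 * t\<^sup>2 * P\<^sup>2 * (u\<^sup>2 + v\<^sup>2))"
    by (simp add: algebra_simps power2_eq_square power3_eq_cube power4_eq_xxxx)
  also have "\<dots> = (2 * pi)\<^sup>2 * (s\<^sup>2 * (A1 * D2 - A2 * D1) + s^3 * t * (P * (u * (D2 - A1) - v * (D1 + A2)))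
     - s^4 * t\<^sup>2 * P\<^sup>2)"
    by (simp add: uv)
  finally have *: "jacobian_formula \<tau> j P dP dQ a b = \<dots>" .
  have m: "(2 * pi * \<alpha> / (norm j * \<tau>\<^sup>2))\<^sup>2 = (2 * pi)\<^sup>2 * (s^4 * t\<^sup>2 * \<alpha>\<^sup>2)"
    by (simp add: s_def t_def divide_inverse algebra_simps power2_eq_square power4_eq_xxxx)
  show ?thesis
    unfolding * m by (simp add: algebra_simps)
qed

text \<open>Each of the three groups of the expansion is compared with \<open>s^3 * t\<close>. The
  first lacks a factor \<open>s * t\<close>, which is at least 1 because
  \<open>\<tau> * norm j \<le> 1\<close>; the second has exactly this order; in the third,
  \<open>P\<^sup>2 - \<alpha>\<^sup>2\<close> supplies a factor \<open>norm j\<close> that cancels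
  one \<open>t\<close>. The contributions 8, 8 and 1 add up to 17, and \<open>1 \<le> K\<close> lets
  \<open>K^4\<close> dominate all lower powers.\<close>

lemma jacobian_formula_error:
  fixes j a b dP dQ :: "real^2"
  assumes "j \<noteq> 0" "1 \<le> \<tau>" "\<tau> * norm j \<le> 1" "1 \<le> K"
    and P: "\<bar>P\<bar> \<le> K" "\<bar>P\<^sup>2 - \<alpha>\<^sup>2\<bar> \<le> K * norm j"
    and bd: "norm dP \<le> K" "norm dQ \<le> K" "norm a \<le> K" "norm b \<le> K"
  shows "\<bar>jacobian_formula \<tau> j P dP dQ a b - (- ((2 * pi * \<alpha> / (norm j * \<tau>\<^sup>2))\<^sup>2))\<bar>
    \<le> (2 * pi)\<^sup>2 * (17 * K^4) * (1 / (norm j * \<tau>^3))"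
proof -
  define s t u v where "s = 1 / \<tau>" "t = 1 / norm j" "u = j$1 / norm j" "v = j$2 / norm j"
  have s: "0 < s" "s \<le> 1" and t: "0 < t" "norm j * t = 1" and uv: "\<bar>u\<bar> \<le> 1" "\<bar>v\<bar> \<le> 1"
    using assms(1,2) component_le_norm_cart[of j] by (auto simp: s_t_u_v_def)
  have "1 \<le> s * t"
    using assms(1-3) by (simp add: s_t_u_v_def field_simps)
  have comp: "\<bar>x $ i - s * P * y $ i\<bar> \<le> 2 * K\<^sup>2" if "norm x \<le> K" "norm y \<le> K" for x y :: "real^2" and i
  proof -
    have "\<bar>s * P * y $ i\<bar> \<le> 1 * K * K"
      unfolding abs_mult using s P that(2) component_le_norm_cart[of y i] \<open>1 \<le> K\<close>
      by (intro mult_mono) auto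
    moreover have "\<bar>x $ i\<bar> \<le> K\<^sup>2"
      using that(1) component_le_norm_cart[of x i] \<open>1 \<le> K\<close> self_le_power[of K 2] by linarith
    ultimately show ?thesis by (simp add: power2_eq_square)
  qed
  define A1 A2 D1 D2 where "A1 = dP$1 - s * P * a$1" "A2 = dP$2 - s * P * a$2"
    "D1 = dQ$1 - s * P * b$1" "D2 = dQ$2 - s * P * b$2"
  have AD: "\<bar>A1\<bar> \<le> 2 * K\<^sup>2" "\<bar>A2\<bar> \<le> 2 * K\<^sup>2" "\<bar>D1\<bar> \<le> 2 * K\<^sup>2" "\<bar>D2\<bar> \<le> 2 * K\<^sup>2"
    unfolding A1_A2_D1_D2_def by (intro comp bd)+
  have K: "K \<le> K^4" "K^3 \<le> K^4"
    using \<open>1 \<le> K\<close> self_le_power[of K 4] power_increasing[of 3 4 K] by auto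
  have prod: "\<bar>X * Y\<bar> \<le> 4 * K^4" if "\<bar>X\<bar> \<le> 2 * K\<^sup>2" "\<bar>Y\<bar> \<le> 2 * K\<^sup>2" for X Y
    using mult_mono[OF that] by (simp add: abs_mult power2_eq_square power4_eq_xxxx mult.assoc)
  have e1: "\<bar>s\<^sup>2 * (A1 * D2 - A2 * D1)\<bar> \<le> s^3 * t * (8 * K^4)"
  proof -
    have "s\<^sup>2 * \<bar>A1 * D2 - A2 * D1\<bar> \<le> s\<^sup>2 * (s * t) * (8 * K^4)"
    proof (intro mult_mono)
      show "s\<^sup>2 \<le> s\<^sup>2 * (s * t)" using \<open>1 \<le> s * t\<close> by (simp add: mult_le_cancel_left1)
      show "\<bar>A1 * D2 - A2 * D1\<bar> \<le> 8 * K^4"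
        using prod[OF AD(1,4)] prod[OF AD(2,3)] by linarith
    qed (use s t in auto)
    then show ?thesis by (simp add: abs_mult power2_eq_square power3_eq_cube mult_ac)
  qed
  have e2: "\<bar>s^3 * t * (P * (u * (D2 - A1) - v * (D1 + A2)))\<bar> \<le> s^3 * t * (8 * K^4)"
  proof -
    have "\<bar>u * (D2 - A1)\<bar> \<le> 1 * (4 * K\<^sup>2)" "\<bar>v * (D1 + A2)\<bar> \<le> 1 * (4 * K\<^sup>2)"
      unfolding abs_mult using AD by (intro mult_mono uv; linarith)+
    then have "\<bar>u * (D2 - A1) - v * (D1 + A2)\<bar> \<le> 8 * K\<^sup>2" by linarith
    then have "\<bar>P * (u * (D2 - A1) - v * (D1 + A2))\<bar> \<le> K * (8 * K\<^sup>2)"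
      unfolding abs_mult using P \<open>1 \<le> K\<close> by (intro mult_mono) auto
    also have "\<dots> \<le> 8 * K^4"
      using K by (simp add: power2_eq_square power3_eq_cube)
    finally show ?thesis
      using s t by (simp add: abs_mult mult_left_mono)
  qed
  have e3: "\<bar>s^4 * t\<^sup>2 * (\<alpha>\<^sup>2 - P\<^sup>2)\<bar> \<le> s^3 * t * K^4"
  proof -
    have "\<bar>s^4 * t\<^sup>2 * (\<alpha>\<^sup>2 - P\<^sup>2)\<bar> = s^4 * t\<^sup>2 * \<bar>P\<^sup>2 - \<alpha>\<^sup>2\<bar>"
      by (simp add: abs_mult abs_minus_commute)
    also have "\<dots> \<le> s^4 * t\<^sup>2 * (K * norm j)"
      using P(2) by (intro mult_left_mono) auto
    also have "\<dots> = s^3 * t * (s * K) * (norm j * t)"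
      by (simp add: power2_eq_square power3_eq_cube power4_eq_xxxx)
    also have "\<dots> \<le> s^3 * t * K^4"
    proof -
      have "s * K \<le> K^4" using s \<open>1 \<le> K\<close> K mult_right_mono[of s 1 K] by linarith
      then show ?thesis using s t by (simp add: mult_left_mono)
    qed
    finally show ?thesis .
  qed
  have total: "\<bar>s\<^sup>2 * (A1 * D2 - A2 * D1) + s^3 * t * (P * (u * (D2 - A1) - v * (D1 + A2))) +
                s^4 * t\<^sup>2 * (\<alpha>\<^sup>2 - P\<^sup>2)\<bar> \<le> 17 * K^4 * (s^3 * t)"
    using e1 e2 e3 by (simp add: algebra_simps)
  have "\<bar>jacobian_formula \<tau> j P dP dQ a b - (- ((2 * pi * \<alpha> / (norm j * \<tau>\<^sup>2))\<^sup>2))\<bar>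
    \<le> (2 * pi)\<^sup>2 * (17 * K^4 * (s^3 * t))"
    unfolding jacobian_formula_expand[OF assms(1)]
    unfolding s_t_u_v_def[symmetric] A1_A2_D1_D2_def[symmetric]
    by (subst abs_mult, rule mult_mono[OF _ total]) (use s t in auto)
  also have "s^3 * t = 1 / (norm j * \<tau>^3)"
    by (simp add: s_t_u_v_def power_divide mult.commute)
  finally show ?thesis by (simp only: mult.assoc)
qed

section \<open>Smooth maps of the plane\<close>

lemma linear_vec2_expand:
  fixes f :: "real^2 \<Rightarrow> 'a::real_vector"
  assumes "linear f"
  shows "f h = h$1 *\<^sub>R f (axis 1 1) + h$2 *\<^sub>R f (axis 2 1)"
proof -
  have "h = h$1 *\<^sub>R axis 1 1 + h$2 *\<^sub>R axis 2 1"
    by (simp add: vec_eq_iff forall_2 axis_def)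
  then show ?thesis
    using linear_add[OF assms] linear_cmul[OF assms] by metis
qed

lemma smooth_on_differentiable: "smooth_on S f \<Longrightarrow> x \<in> S \<Longrightarrow> f differentiable (at x)"
  unfolding smooth_on_def by (metis Ck_on.simps(2))

lemma smooth_on_continuous: "smooth_on S f \<Longrightarrow> continuous_on S f"
  unfolding smooth_on_def by (metis Ck_on.simps(1))

lemma smooth_on_frechet_derivative:
  "smooth_on S f \<Longrightarrow> smooth_on S (\<lambda>x. frechet_derivative f (at x) v)"
  unfolding smooth_on_def by (metis Ck_on.simps(2))

lemma has_derivative_vec_nth:
  "(f has_derivative f') F \<Longrightarrow> ((\<lambda>x. f x $ i) has_derivative (\<lambda>h. f' h $ i)) F"
  by (rule bounded_linear.has_derivative[OF bounded_linear_vec_nth])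

text \<open>Since \<open>Ck_on\<close> uses full derivatives \<open>at x\<close> rather than
  derivatives within \<open>S\<close>, openness of \<open>S\<close> is what makes them depend only
  on the values on \<open>S\<close>.\<close>

lemma Ck_on_cong:
  assumes "open S" "\<And>x. x \<in> S \<Longrightarrow> f x = g x" "Ck_on k S f"
  shows "Ck_on k S g"
  using assms(2,3)
proof (induction k arbitrary: f g)
  case 0
  then show ?case using continuous_on_cong[of S S f g] by simp
next
  case (Suc k)
  have d: "f differentiable (at x)" if "x \<in> S" for x
    using Suc.prems(2) that by simp
  have "g differentiable (at x)" if x: "x \<in> S" for x
  proof -
    obtain f' where "(f has_derivative f') (at x)"
      using d[OF x] unfolding differentiable_def by blast
    then have "(g has_derivative f') (at x)"
      by (rule has_derivative_transform_within_open[OF _ assms(1) x Suc.prems(1)])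
    then show ?thesis by (rule differentiableI)
  qed
  moreover have "frechet_derivative f (at x) = frechet_derivative g (at x)" if "x \<in> S" for x
    by (rule frechet_derivative_transform_within_open[OF d[OF that] assms(1) that Suc.prems(1)])
  then have "Ck_on k S (\<lambda>x. frechet_derivative g (at x) v)" for v
    using Suc.IH[of "\<lambda>x. frechet_derivative f (at x) v"] Suc.prems(2) by simp
  ultimately show ?case by simp
qed

text \<open>Taking a component commutes with differentiation. The two derivatives are known to agree
  only on \<open>S\<close>, so the induction step passes through \<open>Ck_on_cong\<close>.\<close>

lemma Ck_on_vec_nth:
  assumes "open S" "Ck_on k S f"
  shows "Ck_on k S (\<lambda>x. f x $ i)"
  using assms(2)
proof (induction k arbitrary: f)
  case 0
  then show ?case by (auto intro: continuous_intros)
next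
  case (Suc k)
  have D: "((\<lambda>x. f x $ i) has_derivative (\<lambda>h. frechet_derivative f (at x) h $ i)) (at x)"
    if "x \<in> S" for x
    using Suc.prems that by (auto intro: has_derivative_vec_nth simp: frechet_derivative_works[symmetric])
  have "Ck_on k S (\<lambda>x. frechet_derivative (\<lambda>x. f x $ i) (at x) v)" for v
    by (rule Ck_on_cong[OF assms(1) _ Suc.IH])
       (use Suc.prems frechet_derivative_at[OF D] in \<open>auto simp: fun_eq_iff\<close>)
  then show ?case
    using D by (auto simp: differentiable_def)
qed

lemma smooth_on_vec_nth: "open S \<Longrightarrow> smooth_on S f \<Longrightarrow> smooth_on S (\<lambda>x. f x $ i)"
  unfolding smooth_on_def using Ck_on_vec_nth by blast

definition gradient :: "(real^2 \<Rightarrow> real) \<Rightarrow> real^2 \<Rightarrow> real^2" where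
  "gradient f j = (\<chi> i. frechet_derivative f (at j) (axis i 1))"

lemma has_derivative_gradient:
  assumes "f differentiable (at x)"
  shows "(f has_derivative (\<lambda>h. gradient f x \<bullet> h)) (at x)"
proof -
  have "frechet_derivative f (at x) = (\<lambda>h. gradient f x \<bullet> h)"
  proof
    show "frechet_derivative f (at x) h = gradient f x \<bullet> h" for h
      by (subst linear_vec2_expand[OF linear_frechet_derivative[OF assms]])
         (simp add: gradient_def inner_vec_def sum_2 mult.commute)
  qed
  then show ?thesis
    using assms frechet_derivative_works by metis
qed

lemma isCont_gradient:
  assumes "open S" "x \<in> S" "smooth_on S f"
  shows "isCont (gradient f) x"
  unfolding gradient_def
proof (intro continuous_within[THEN iffD2] tendsto_vec_lambda)
  fix i :: 2
  have "continuous_on S (\<lambda>x. frechet_derivative f (at x) (axis i 1))"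
    using assms(3) by (intro smooth_on_continuous smooth_on_frechet_derivative)
  then have "isCont (\<lambda>x. frechet_derivative f (at x) (axis i 1)) x"
    using assms by (simp add: continuous_on_eq_continuous_at)
  then show "((\<lambda>x. frechet_derivative f (at x) (axis i 1)) \<longlongrightarrow> frechet_derivative f (at x) (axis i 1)) (at x)"
    by (simp add: isCont_def)
qed

section \<open>Jacobian determinants under a change of coordinates\<close>

lemma has_derivative_pair_map:
  assumes "(f has_derivative f') (at x)" "(g has_derivative g') (at x)"
  shows "(pair_map f g has_derivative (\<lambda>h. vector [f' h, g' h])) (at x)"
proof -
  have eq: "vector [a, b] = a *\<^sub>R (axis 1 1 :: real^2) + b *\<^sub>R axis 2 1" for a b :: real
    by (simp add: vec_eq_iff forall_2 axis_def)
  show ?thesis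
    unfolding pair_map_def eq using assms by (auto intro!: derivative_eq_intros)
qed

lemma det_pair_map:
  assumes "(f has_derivative f') (at (x::real^2))" "(g has_derivative g') (at x)"
  shows "det (matrix (frechet_derivative (pair_map f g) (at x))) =
    f' (axis 1 1) * g' (axis 2 1) - f' (axis 2 1) * g' (axis 1 1)"
  by (simp add: det_2 matrix_def flip: frechet_derivative_at[OF has_derivative_pair_map[OF assms]])

text \<open>The identity \<open>inv_into U I (I x) = x\<close> holds on the open set
  \<open>U\<close> and is differentiated at \<open>j\<close>.\<close>

lemma diffeo_on_local_inverse:
  fixes I :: "real^'n::finite \<Rightarrow> real^'n"
  assumes I: "diffeo_on U I" and j: "j \<in> U"
  obtains V' where "(inv_into U I has_derivative V') (at (I j))"
    "V' \<circ> frechet_derivative I (at j) = id"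
proof -
  have op: "open U" "open (I ` U)" and inj: "inj_on I U"
    and sm: "smooth_on U I" "smooth_on (I ` U) (inv_into U I)"
    using I unfolding diffeo_on_def by auto
  have 1: "(I has_derivative frechet_derivative I (at j)) (at j)"
    using smooth_on_differentiable[OF sm(1) j] frechet_derivative_works by blast
  obtain V' where 2: "(inv_into U I has_derivative V') (at (I j))"
    using smooth_on_differentiable[OF sm(2), of "I j"] j unfolding differentiable_def by auto
  have "((\<lambda>x. inv_into U I (I x)) has_derivative V' \<circ> frechet_derivative I (at j)) (at j)"
    using diff_chain_at[OF 1 2] by (simp add: o_def)
  moreover have "((\<lambda>x. inv_into U I (I x)) has_derivative id) (at j)"
    by (rule has_derivative_transform_within_open[OF has_derivative_id op(1) j])
       (simp add: inj)
  ultimately have "V' \<circ> frechet_derivative I (at j) = id"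
    by (rule has_derivative_unique)
  with 2 that show thesis by blast
qed

text \<open>Serves for a map \<open>\<omega>\<close> known only through its composite with
  \<open>I\<close>: near \<open>I j\<close> it coincides with \<open>G \<circ> inv_into U I\<close>,
  so differentiability is a conclusion and not a hypothesis. The determinant rule is the chain rule
  in product form.\<close>

lemma diffeo_on_jacobian:
  fixes I \<omega> G :: "real^'n::finite \<Rightarrow> real^'n"
  assumes I: "diffeo_on U I" and j: "j \<in> U"
    and G: "(G has_derivative G') (at j)"
    and T: "open T" "j \<in> T" "\<And>x. x \<in> T \<Longrightarrow> \<omega> (I x) = G x"
  shows "\<omega> differentiable (at (I j))"
    and "det (matrix (frechet_derivative \<omega> (at (I j)))) * det (matrix (frechet_derivative I (at j)))
      = det (matrix G')"
proof -
  obtain V' where V: "(inv_into U I has_derivative V') (at (I j))"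
    and id: "V' \<circ> frechet_derivative I (at j) = id"
    using diffeo_on_local_inverse[OF I j] .
  have op: "open U" "open (I ` U)" and inj: "inj_on I U"
    and sm: "smooth_on U I" "smooth_on (I ` U) (inv_into U I)"
    using I unfolding diffeo_on_def by auto
  \<comment> \<open>The neighbourhood of \<open>I j\<close> on which \<open>\<omega>\<close> is
    controlled; it is open because the inverse is continuous on the open image.\<close>
  define N where "N = inv_into U I -` T \<inter> I ` U"
  have N: "open N"
    unfolding N_def using smooth_on_continuous[OF sm(2)] op(2) T(1) continuous_on_open_vimage
    by blast
  have jN: "I j \<in> N"
    using j T inj by (simp add: N_def)
  have "(G \<circ> inv_into U I has_derivative G' \<circ> V') (at (I j))"
    using diff_chain_at[OF V, of G G'] G j inj by simp
  then have \<omega>: "(\<omega> has_derivative G' \<circ> V') (at (I j))"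
  proof (rule has_derivative_transform_within_open[OF _ N jN])
    fix y assume "y \<in> N"
    then obtain x where "x \<in> U" "y = I x" "x \<in> T"
      using inj by (auto simp: N_def)
    then show "(G \<circ> inv_into U I) y = \<omega> y" using T(3) inj by simp
  qed
  then show "\<omega> differentiable (at (I j))" unfolding differentiable_def by blast
  have lin: "linear G'" "linear V'" "linear (frechet_derivative I (at j))"
    using G V smooth_on_differentiable[OF sm(1) j]
    by (auto dest: has_derivative_linear linear_frechet_derivative)
  have "det (matrix (G' \<circ> V')) * det (matrix (frechet_derivative I (at j))) =
      det (matrix ((G' \<circ> V') \<circ> frechet_derivative I (at j)))"
    using lin by (simp add: matrix_compose det_mul linear_compose)
  also have "(G' \<circ> V') \<circ> frechet_derivative I (at j) = G'"
    using id by (metis comp_assoc comp_id)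
  finally show "det (matrix (frechet_derivative \<omega> (at (I j)))) *
      det (matrix (frechet_derivative I (at j))) = det (matrix G')"
    using frechet_derivative_at[OF \<omega>] by simp
qed

text \<open>Taking the inverse for \<open>\<omega>\<close> and the identity for \<open>G\<close> in
  \<open>diffeo_on_jacobian\<close>, the product of the two determinants is 1.\<close>

lemma diffeo_on_det_nonzero:
  fixes I :: "real^'n::finite \<Rightarrow> real^'n"
  assumes "diffeo_on U I" "j \<in> U"
  shows "det (matrix (frechet_derivative I (at j))) \<noteq> 0"
proof
  assume "det (matrix (frechet_derivative I (at j))) = 0"
  moreover have "inv_into U I (I x) = x" "open U" if "x \<in> U" for x
    using assms that by (auto simp: diffeo_on_def)
  ultimately have "0 = det (matrix (\<lambda>x::real^'n. x))"
    using diffeo_on_jacobian(2)[OF assms has_derivative_ident, of U "inv_into U I"] assms(2)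
    by simp
  then show False by (simp add: matrix_id_mat_1[unfolded id_def])
qed

section \<open>The logarithmic functions\<close>

lemma zeta_eq_0_iff [simp]: "zeta j = 0 \<longleftrightarrow> j = 0"
  by (auto simp: zeta_def complex_eq_iff vec_eq_iff forall_2)

lemma norm_zeta [simp]: "norm (zeta j) = norm j"
  by (simp add: zeta_def cmod_def norm_vec_def L2_set_def sum_2)

lemma bounded_linear_zeta: "bounded_linear zeta"
  unfolding linear_conv_bounded_linear[symmetric] by (rule linearI) (simp_all add: zeta_def complex_eq_iff)

lemma open_zeta_image: "open U \<Longrightarrow> open (zeta ` U)"
proof -
  assume "open U"
  have "continuous_on UNIV (\<lambda>z. Re z *\<^sub>R (axis 1 1 :: real^2) + Im z *\<^sub>R axis 2 1)"
    by (intro continuous_intros)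
  then have "open ((\<lambda>z. Re z *\<^sub>R (axis 1 1 :: real^2) + Im z *\<^sub>R axis 2 1) -` U)"
    using \<open>open U\<close> continuous_on_open_vimage[of UNIV] by force
  also have "(\<lambda>z. Re z *\<^sub>R (axis 1 1 :: real^2) + Im z *\<^sub>R axis 2 1) -` U = zeta ` U"
  proof (intro equalityI subsetI)
    fix z assume "z \<in> (\<lambda>z. Re z *\<^sub>R (axis 1 1 :: real^2) + Im z *\<^sub>R axis 2 1) -` U"
    moreover have "z = zeta (Re z *\<^sub>R (axis 1 1 :: real^2) + Im z *\<^sub>R axis 2 1)"
      by (simp add: zeta_def axis_def complex_eq_iff)
    ultimately show "z \<in> zeta ` U" by blast
  next
    fix z assume "z \<in> zeta ` U"
    then obtain j where "j \<in> U" "z = zeta j" by blast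
    moreover have "Re (zeta j) *\<^sub>R (axis 1 1 :: real^2) + Im (zeta j) *\<^sub>R axis 2 1 = j"
      by (simp add: zeta_def axis_def vec_eq_iff forall_2)
    ultimately show "z \<in> (\<lambda>z. Re z *\<^sub>R (axis 1 1 :: real^2) + Im z *\<^sub>R axis 2 1) -` U"
      by simp
  qed
  finally show ?thesis .
qed

lemma tau1_eq: "j \<noteq> 0 \<Longrightarrow> tau1 \<sigma> j = \<sigma> j - ln (norm j)"
  by (simp add: tau1_def)

lemma has_derivative_tau1:
  assumes "(\<sigma> has_derivative \<sigma>') (at j)" "j \<noteq> 0"
  shows "(tau1 \<sigma> has_derivative (\<lambda>h. \<sigma>' h - (j \<bullet> h) / (norm j)\<^sup>2)) (at j)"
proof -
  have "((\<lambda>j. \<sigma> j - ln (norm j)) has_derivative (\<lambda>h. \<sigma>' h - (j \<bullet> h) / (norm j)\<^sup>2)) (at j)"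
    using assms
    by (auto intro!: derivative_eq_intros has_derivative_norm[THEN has_derivative_compose]
        simp: fun_eq_iff sgn_div_norm power2_eq_square divide_inverse inner_commute)
  then show ?thesis
    by (rule has_derivative_transform_within_open[where s = "- {0}"]) (use assms in \<open>auto simp: tau1_eq\<close>)
qed

text \<open>A branch is only assumed to be a continuous right inverse of \<open>exp\<close>. The
  inverse function rule makes it complex differentiable with derivative \<open>1 / z\<close>, so the
  derivative of \<open>tau2\<close> is the same for every branch.\<close>

lemma has_derivative_tau2:
  assumes \<sigma>: "(\<sigma> has_derivative \<sigma>') (at j)" and "j \<noteq> 0"
    and U: "open U" "j \<in> U" and lg: "log_branch (zeta ` U) lg"
  shows "(tau2 \<sigma> lg has_derivative (\<lambda>h. \<sigma>' h + Im (zeta h / zeta j))) (at j)"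
proof -
  have e: "exp (lg z) = z" if "z \<in> zeta ` U" for z using lg that unfolding log_branch_def by blast
  have "(lg has_field_derivative inverse (exp (lg (zeta j)))) (at (zeta j))"
  proof (rule has_field_derivative_inverse_basic[where t = "zeta ` U" and f = exp])
    show "(exp has_field_derivative exp (lg (zeta j))) (at (lg (zeta j)))"
      by (rule DERIV_exp)
    show "isCont lg (zeta j)"
      using lg U open_zeta_image[OF U(1)] by (auto simp: log_branch_def continuous_on_eq_continuous_at)
  qed (use U open_zeta_image e \<open>j \<noteq> 0\<close> in simp_all)
  then have "(lg has_derivative (*) (inverse (zeta j))) (at (zeta j))"
    using e[of "zeta j"] U by (simp add: has_field_derivative_def)
  then have "((\<lambda>x. lg (zeta x)) has_derivative (\<lambda>h. inverse (zeta j) * zeta h)) (at j)"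
    using diff_chain_at[OF bounded_linear_imp_has_derivative[OF bounded_linear_zeta]]
    by (force simp: o_def)
  then have "((\<lambda>x. Im (lg (zeta x))) has_derivative (\<lambda>h. Im (inverse (zeta j) * zeta h))) (at j)"
    by (rule bounded_linear.has_derivative[OF bounded_linear_Im])
  from has_derivative_add[OF \<sigma> this] show ?thesis
    unfolding tau2_def[abs_def] by (simp add: divide_inverse mult.commute)
qed

section \<open>Growth of \<open>tau1\<close> at the origin\<close>

lemma filterlim_norm_at_right_0: "filterlim (\<lambda>j::'a::real_normed_vector. norm j) (at_right 0) (at 0)"
  by (intro tendsto_imp_filterlim_at_right tendsto_norm_zero)
     (auto intro: tendsto_ident_at simp: eventually_at_filter)

lemma filterlim_ln_norm_at_0: "filterlim (\<lambda>j::'a::real_normed_vector. ln (norm j)) at_bot (at 0)"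
  by (rule filterlim_compose[OF ln_at_0 filterlim_norm_at_right_0])

lemma tau1_at_top:
  assumes "isCont \<sigma> 0"
  shows "filterlim (tau1 \<sigma>) at_top (at 0)"
proof -
  have "filterlim (\<lambda>j. \<sigma> j + (- ln (norm j))) at_top (at 0)"
    using assms[unfolded isCont_def]
    by (intro filterlim_tendsto_add_at_top) (simp_all add: filterlim_ln_norm_at_0 flip: filterlim_uminus_at_bot)
  then show ?thesis
    by (rule filterlim_cong[THEN iffD1, rotated -1]) (auto simp: eventually_at_filter tau1_eq)
qed

text \<open>The quotient of \<open>tau1\<close> by \<open>ln (norm j)\<close> tends to -1, since
  \<sigma> has a finite limit.\<close>

lemma tau1_bigtheta:
  assumes "isCont \<sigma> 0"
  shows "tau1 \<sigma> \<in> \<Theta>[at 0](\<lambda>j. ln (norm j))"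
proof -
  note ln = filterlim_ln_norm_at_0[where 'a = "real^2"]
  then have ne: "\<forall>\<^sub>F j in at (0::real^2). ln (norm j) < 0 \<and> j \<noteq> 0"
    by (simp add: filterlim_at_bot_dense eventually_conj_iff eventually_neq_at_within)
  have "((\<lambda>j. \<sigma> j / ln (norm j) - 1) \<longlongrightarrow> 0 - 1) (at 0)"
    using assms[unfolded isCont_def]
    by (intro tendsto_diff tendsto_divide_0 tendsto_const filterlim_at_bot_imp_at_infinity ln)
  moreover have "\<forall>\<^sub>F j in at 0. \<sigma> j / ln (norm j) - 1 = tau1 \<sigma> j / ln (norm j)"
    using ne by eventually_elim (auto simp: tau1_eq field_simps)
  ultimately have "((\<lambda>j. tau1 \<sigma> j / ln (norm j)) \<longlongrightarrow> - 1) (at 0)"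
    by (auto intro: Lim_transform_eventually)
  then show ?thesis
    by (intro bigthetaI_tendsto[of "- 1"]) simp_all
qed

text \<open>With \<open>y = 1 / norm j\<close> the logarithmic part is \<open>ln y / y\<close>,
  which vanishes as \<open>y\<close> grows. This limit is what places the error term below the
  leading term.\<close>

lemma tau1_mult_norm_tendsto_0:
  assumes "isCont \<sigma> 0"
  shows "((\<lambda>j. tau1 \<sigma> j * norm j) \<longlongrightarrow> 0) (at 0)"
proof -
  have "((\<lambda>j::real^2. ln (inverse (norm j)) / inverse (norm j)) \<longlongrightarrow> 0) (at 0)"
    by (rule filterlim_compose[OF ln_x_over_x_tendsto_0
          filterlim_compose[OF filterlim_inverse_at_top_right filterlim_norm_at_right_0]])
  moreover have "((\<lambda>j. \<sigma> j * norm j) \<longlongrightarrow> \<sigma> 0 * 0) (at 0)"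
    using assms[unfolded isCont_def] by (intro tendsto_mult tendsto_norm_zero tendsto_ident_at)
  ultimately have "((\<lambda>j. \<sigma> j * norm j + ln (inverse (norm j)) / inverse (norm j)) \<longlongrightarrow> 0) (at 0)"
    using tendsto_add by fastforce
  then show ?thesis
    by (rule Lim_transform_eventually)
       (auto simp: eventually_at_filter tau1_eq ln_inverse divide_inverse algebra_simps)
qed

section \<open>Hamiltonian vector fields\<close>

lemma param_snd:
  assumes "is_chart c" "p \<in> fst c"
  shows "param c (snd c p) = p"
  using assms unfolding is_chart_def homeomorphism_def by blast

lemma open_chart_image:
  assumes c: "is_chart c" and W: "open W"
  shows "open (snd c ` (fst c \<inter> W))"
proof -
  have "open (param c -` W \<inter> snd c ` fst c)"
    using c W continuous_on_open_vimage homeomorphism_cont2 unfolding is_chart_def by blast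
  also have "param c -` W \<inter> snd c ` fst c = snd c ` (fst c \<inter> W)"
    using param_snd[OF c] by auto
  finally show ?thesis .
qed

text \<open>\<open>ham_vf\<close> is a definite description; nondegeneracy provides the
  uniqueness.\<close>

lemma ham_vf_eqI:
  assumes \<Omega>: "symplectic_form A \<Omega>" and c: "c \<in> A" "p \<in> fst c"
    and v: "\<And>w. \<Omega> c (snd c p) v w = differential f c p w"
  shows "ham_vf \<Omega> f c p = v"
  unfolding ham_vf_def
proof (rule the_equality)
  fix v' assume "\<forall>w. \<Omega> c (snd c p) v' w = differential f c p w"
  moreover have "bilinear (\<Omega> c (snd c p))" and nondeg: "\<And>v. (\<And>w. \<Omega> c (snd c p) v w = 0) \<Longrightarrow> v = 0"
    using \<Omega> c unfolding symplectic_form_def by blast+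
  ultimately have "v' - v = 0"
    using v by (intro nondeg) (simp add: bilinear_lsub)
  then show "v' = v" by simp
qed (use v in blast)

text \<open>Existence for the definite description: contraction with the form is injective by
  nondegeneracy, hence surjective onto covectors for reasons of dimension.\<close>

lemma ham_vf_form:
  assumes \<Omega>: "symplectic_form A \<Omega>" and c: "c \<in> A" "p \<in> fst c"
    and f: "(f \<circ> param c) differentiable (at (snd c p))"
  shows "\<Omega> c (snd c p) (ham_vf \<Omega> f c p) w = differential f c p w"
proof -
  define b where "b = \<Omega> c (snd c p)"
  have bil: "bilinear b" and nondeg: "\<And>v. (\<And>w. b v w = 0) \<Longrightarrow> v = 0"
    using \<Omega> c unfolding symplectic_form_def b_def by blast+
  have ext: "k = l" if "linear k" "linear l" "\<And>i. k (axis i 1) = l (axis i 1)"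
    for k l :: "real^4 \<Rightarrow> real"
  proof (rule linear_eq_stdbasis[OF that(1,2)])
    fix e :: "real^4" assume "e \<in> Basis"
    then show "k e = l e" using that(3) by (auto simp: Basis_vec_def)
  qed
  \<comment> \<open>The covector \<open>b v\<close> is coded by its components on the axis vectors,
    so that \<open>T\<close> is an endomorphism of \<open>real^4\<close> and injectivity yields
    surjectivity.\<close>
  define T where "T v = (\<chi> i. b v (axis i 1))" for v
  have linb: "linear (b v)" for v using bil by (simp add: bilinear_def)
  have linT: "linear T"
    by (rule linearI) (simp_all add: T_def vec_eq_iff bilinear_ladd[OF bil] bilinear_lmul[OF bil])
  have "inj T"
  proof (subst linear_injective_0[OF linT], intro allI impI)
    fix v assume "T v = 0"
    then have "b v (axis i 1) = 0" for i by (simp add: T_def vec_eq_iff)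
    then have "b v = (\<lambda>w. 0)"
      by (intro ext linb) (auto intro: linearI)
    then show "v = 0" using nondeg by metis
  qed
  then have "surj T" by (rule linear_injective_imp_surjective[OF linT]) simp
  then obtain v where "T v = (\<chi> i. differential f c p (axis i 1))"
    by (metis surjD)
  then have "b v = differential f c p"
    using linear_frechet_derivative[OF f]
    by (intro ext linb) (auto simp: T_def vec_eq_iff differential_def)
  then show ?thesis
    using ham_vf_eqI[OF \<Omega> c, of v f] by (simp add: b_def)
qed

section \<open>Hamiltonian fields of functions of the momentum map\<close>

lemma differential_compose:
  fixes J :: "'m \<Rightarrow> real^2"
  assumes J: "(J \<circ> param c) differentiable (at (snd c p))" and p: "param c (snd c p) = p"
    and f: "(f has_derivative f') (at (J p))"
  shows "((\<lambda>q. f (J q)) \<circ> param c) differentiable (at (snd c p))"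
    and "differential (\<lambda>q. f (J q)) c p w = f' (frechet_derivative (J \<circ> param c) (at (snd c p)) w)"
proof -
  have "(f \<circ> (J \<circ> param c) has_derivative
      f' \<circ> frechet_derivative (J \<circ> param c) (at (snd c p))) (at (snd c p))"
    using J f p by (intro diff_chain_at) (simp_all flip: frechet_derivative_works)
  then have D: "((\<lambda>q. f (J q)) \<circ> param c has_derivative
      f' \<circ> frechet_derivative (J \<circ> param c) (at (snd c p))) (at (snd c p))"
    by (simp add: o_def)
  then show "((\<lambda>q. f (J q)) \<circ> param c) differentiable (at (snd c p))"
    by (auto simp: differentiable_def)
  show "differential (\<lambda>q. f (J q)) c p w = f' (frechet_derivative (J \<circ> param c) (at (snd c p)) w)"
    unfolding differential_def using frechet_derivative_at[OF D] by (simp add: fun_eq_iff)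
qed

text \<open>The differential of \<open>f \<circ> J\<close> is a combination of those of the two
  components of \<open>J\<close>, and the form is linear in its first slot.\<close>

lemma ham_vf_compose:
  fixes J :: "'m::{t2_space,second_countable_topology} \<Rightarrow> real^2"
  assumes \<Omega>: "symplectic_form A \<Omega>" and c: "c \<in> A" "p \<in> fst c" "is_chart c"
    and J: "(J \<circ> param c) differentiable (at (snd c p))"
    and f: "(f has_derivative f') (at (J p))"
  shows "ham_vf \<Omega> (\<lambda>q. f (J q)) c p =
    f' (axis 1 1) *\<^sub>R ham_vf \<Omega> (\<lambda>q. J q $ 1) c p + f' (axis 2 1) *\<^sub>R ham_vf \<Omega> (\<lambda>q. J q $ 2) c p"
proof (rule ham_vf_eqI[OF \<Omega> c(1,2)])
  fix w
  have bil: "bilinear (\<Omega> c (snd c p))"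
    using \<Omega> c unfolding symplectic_form_def by blast
  note dc = differential_compose[OF J param_snd[OF c(3,2)]]
  note nth = has_derivative_vec_nth[OF has_derivative_ident]
  show "\<Omega> c (snd c p) (f' (axis 1 1) *\<^sub>R ham_vf \<Omega> (\<lambda>q. J q $ 1) c p +
      f' (axis 2 1) *\<^sub>R ham_vf \<Omega> (\<lambda>q. J q $ 2) c p) w = differential (\<lambda>q. f (J q)) c p w"
    unfolding bilinear_ladd[OF bil] bilinear_lmul[OF bil] ham_vf_form[OF \<Omega> c(1,2) dc(1)[OF nth]]
      dc(2)[OF nth] dc(2)[OF f]
    using linear_vec2_expand[OF has_derivative_linear[OF f],
        of "frechet_derivative (J \<circ> param c) (at (snd c p)) w"]
    by (simp add: mult.commute)
qed

text \<open>Pairing with the form turns a relation between the two fields into one between the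
  differentials, which regularity excludes. This justifies comparing coefficients.\<close>

lemma ham_vf_independent:
  fixes J :: "'m::{t2_space,second_countable_topology} \<Rightarrow> real^2"
  assumes \<Omega>: "symplectic_form A \<Omega>" and c: "c \<in> A" "p \<in> fst c" "is_chart c"
    and J: "(J \<circ> param c) differentiable (at (snd c p))" and reg: "regular_at A J p"
    and eq: "a *\<^sub>R ham_vf \<Omega> (\<lambda>q. J q $ 1) c p + b *\<^sub>R ham_vf \<Omega> (\<lambda>q. J q $ 2) c p =
      a' *\<^sub>R ham_vf \<Omega> (\<lambda>q. J q $ 1) c p + b' *\<^sub>R ham_vf \<Omega> (\<lambda>q. J q $ 2) c p"
  shows "a = a' \<and> b = b'"
proof -
  have bil: "bilinear (\<Omega> c (snd c p))"
    using \<Omega> c unfolding symplectic_form_def by blast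
  note dc = differential_compose[OF J param_snd[OF c(3,2)]]
  note nth = has_derivative_vec_nth[OF has_derivative_ident]
  have "(a - a') * differential (\<lambda>q. J q $ 1) c p w + (b - b') * differential (\<lambda>q. J q $ 2) c p w = 0" for w
    using arg_cong[OF eq, of "\<lambda>v. \<Omega> c (snd c p) v w"]
    unfolding bilinear_ladd[OF bil] bilinear_lmul[OF bil] ham_vf_form[OF \<Omega> c(1,2) dc(1)[OF nth]]
    by (simp add: algebra_simps)
  then have "a - a' = 0 \<and> b - b' = 0"
    using reg c unfolding regular_at_def by blast
  then show ?thesis by simp
qed

text \<open>\<open>J\<close> is prescribed on \<open>W\<close> alone, so in a chart it is compared
  with the inverse of \<open>F\<close> after \<open>(H, L)\<close> on the open coordinate image of
  \<open>W\<close>.\<close>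

lemma momentum_differentiable:
  fixes J :: "'m::{t2_space,second_countable_topology} \<Rightarrow> real^2"
  assumes M: "smooth_structure M A" and H: "smooth_function A M H" and L: "smooth_function A M L"
    and F: "diffeo_on B F" and W: "open W" "W \<subseteq> M"
    and J: "\<forall>p\<in>W. pair_map H L p \<in> F ` B \<and> J p = inv_into B F (pair_map H L p)"
    and c: "c \<in> A" "p \<in> fst c" "p \<in> W"
  shows "(J \<circ> param c) differentiable (at (snd c p))"
proof -
  have ch: "is_chart c" and cM: "fst c \<subseteq> M" using M c unfolding smooth_structure_def by auto
  have d: "(h \<circ> param c) differentiable (at (snd c p))" if "smooth_function A M h" for h
    using that c cM W smooth_on_differentiable[of "snd c ` (fst c \<inter> M)" "h \<circ> param c" "snd c p"]
    unfolding smooth_function_def by auto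
  have "pair_map (H \<circ> param c) (L \<circ> param c) differentiable (at (snd c p))"
    using d[OF H] d[OF L] has_derivative_pair_map unfolding differentiable_def by blast
  moreover have "pair_map (H \<circ> param c) (L \<circ> param c) = pair_map H L \<circ> param c"
    by (simp add: pair_map_def fun_eq_iff)
  moreover have "inv_into B F differentiable (at ((pair_map H L \<circ> param c) (snd c p)))"
    using F J c param_snd[OF ch c(2)] by (auto simp: diffeo_on_def intro: smooth_on_differentiable)
  ultimately have "inv_into B F \<circ> (pair_map H L \<circ> param c) differentiable (at (snd c p))"
    using differentiable_chain_at by metis
  then obtain D where D: "(inv_into B F \<circ> (pair_map H L \<circ> param c) has_derivative D) (at (snd c p))"
    unfolding differentiable_def by blast
  have "(J \<circ> param c has_derivative D) (at (snd c p))"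
    by (rule has_derivative_transform_within_open[OF D open_chart_image[OF ch W(1)]])
       (use J c param_snd[OF ch] in auto)
  then show ?thesis by (rule differentiableI)
qed

section \<open>The frequency map\<close>

text \<open>Differentiating at \<open>j\<close> requires the formula for the frequencies on a whole
  neighbourhood. \<open>T\<close> provides one on which \<open>tau1\<close> does not vanish and each
  value of \<open>J\<close> is attained at a regular point. There every admissible \<omega> is
  forced to agree with the explicit expression.\<close>

lemma frequency_jacobian_eq:
  fixes M :: "'m::{t2_space,second_countable_topology} set" and J :: "'m \<Rightarrow> real^2"
    and \<Phi> :: "real^2 \<Rightarrow> real"
  defines "P \<equiv> \<lambda>x. gradient \<Phi> x $ 1" and "Q \<equiv> \<lambda>x. gradient \<Phi> x $ 2"
  assumes M: "smooth_structure M A" and \<Omega>: "symplectic_form A \<Omega>"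
    and H: "smooth_function A M H" and L: "smooth_function A M L"
    and F: "diffeo_on B (pair_map \<Phi> \<Psi>)"
    and W: "open W" "W \<subseteq> M"
    and J: "\<forall>p\<in>W. pair_map H L p \<in> pair_map \<Phi> \<Psi> ` B \<and>
             J p = inv_into B (pair_map \<Phi> \<Psi>) (pair_map H L p)"
    and \<sigma>: "\<sigma>1 differentiable (at j)" "\<sigma>2 differentiable (at j)"
    and T: "open T" "0 \<notin> T" "j \<in> T" "\<And>x. x \<in> T \<Longrightarrow> tau1 \<sigma>1 x \<noteq> 0"
      "\<And>x. x \<in> T \<Longrightarrow> \<exists>p\<in>W. J p = x \<and> regular_at A J p"
    and U: "j \<in> U" "first_action A \<Omega> W J \<sigma>1 \<sigma>2 U lg I1"
  shows "frequency_jacobian A \<Omega> W J H U (pair_map I1 (\<lambda>j. j$2)) j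
    (jacobian_formula (tau1 \<sigma>1 j) j (P j) (gradient P j) (gradient Q j) (gradient \<sigma>1 j) (gradient \<sigma>2 j))"
proof -
  define I where "I = pair_map I1 (\<lambda>j. j$2)"
  have I_nth: "I x $ 1 = I1 x" "I x $ 2 = x $ 2" for x
    by (simp_all add: I_def pair_map_def)
  have oU: "open U" and lg: "log_branch (zeta ` U) lg" and I: "diffeo_on U I"
    using U(2) by (auto simp: first_action_def action_variables_def I_def)
  have X_I1: "(2 * pi) *\<^sub>R ham_vf \<Omega> (\<lambda>q. I1 (J q)) c p =
      tau1 \<sigma>1 (J p) *\<^sub>R ham_vf \<Omega> (\<lambda>q. J q $ 1) c p +
      tau2 \<sigma>2 lg (J p) *\<^sub>R ham_vf \<Omega> (\<lambda>q. J q $ 2) c p"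
    if "p \<in> W" "J p \<in> U" "c \<in> A" "p \<in> fst c" for p c
    using U(2)[unfolded first_action_def] that by simp
  have sB: "open B" "smooth_on B (pair_map \<Phi> \<Psi>)" using F by (auto simp: diffeo_on_def)
  have s\<Phi>: "smooth_on B \<Phi>"
    using smooth_on_vec_nth[OF sB, of 1] by (simp add: pair_map_def)
  have sP: "smooth_on B P" and sQ: "smooth_on B Q"
    using smooth_on_frechet_derivative[OF s\<Phi>] by (simp_all add: P_def Q_def gradient_def)
  have JB: "J p \<in> B" and HJ: "H p = \<Phi> (J p)" if "p \<in> W" for p
  proof -
    have "pair_map H L p \<in> pair_map \<Phi> \<Psi> ` B" "J p = inv_into B (pair_map \<Phi> \<Psi>) (pair_map H L p)"
      using J that by auto
    then have "J p \<in> B" "pair_map \<Phi> \<Psi> (J p) = pair_map H L p"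
      by (simp_all add: inv_into_into f_inv_into_f)
    then show "J p \<in> B" "H p = \<Phi> (J p)"
      by (auto simp: pair_map_def vec_eq_iff forall_2)
  qed
  have chart: "is_chart c" if "c \<in> A" for c using M that by (auto simp: smooth_structure_def)
  have dJ: "(J \<circ> param c) differentiable (at (snd c p))" if "c \<in> A" "p \<in> fst c" "p \<in> W" for c p
    by (rule momentum_differentiable[OF M H L F W J that])
  have dI: "(I1 has_derivative (\<lambda>h. gradient I1 x \<bullet> h)) (at x)" if "x \<in> U" for x
  proof (rule has_derivative_gradient)
    have "smooth_on U (\<lambda>x. I x $ 1)"
      using I oU by (intro smooth_on_vec_nth) (auto simp: diffeo_on_def)
    then show "I1 differentiable (at x)"
      using smooth_on_differentiable[OF _ that] by (simp add: I_nth)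
  qed
  \<comment> \<open>The second component of \<open>I\<close> is \<open>j$2\<close>, so the Jacobian
    matrix is triangular with 1 as its other diagonal entry.\<close>
  have det_I: "det (matrix (frechet_derivative I (at x))) = gradient I1 x $ 1" if "x \<in> U" for x
    unfolding I_def det_pair_map[OF dI[OF that] has_derivative_vec_nth[OF has_derivative_ident]]
    by (simp add: inner_axis) (simp add: axis_def)
  have I11: "gradient I1 x $ 1 \<noteq> 0" if "x \<in> U" for x
    using diffeo_on_det_nonzero[OF I that] det_I[OF that] by simp
  have X_I: "ham_vf \<Omega> (\<lambda>q. I1 (J q)) c p =
      gradient I1 (J p) $ 1 *\<^sub>R ham_vf \<Omega> (\<lambda>q. J q $ 1) c p +
      gradient I1 (J p) $ 2 *\<^sub>R ham_vf \<Omega> (\<lambda>q. J q $ 2) c p"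
    if "p \<in> W" "J p \<in> U" "c \<in> A" "p \<in> fst c" for p c
    using ham_vf_compose[OF \<Omega> that(3,4) chart dJ dI] that by (simp add: inner_axis)
  have X_H: "ham_vf \<Omega> H c p = P (J p) *\<^sub>R ham_vf \<Omega> (\<lambda>q. J q $ 1) c p +
      Q (J p) *\<^sub>R ham_vf \<Omega> (\<lambda>q. J q $ 2) c p"
    if "p \<in> W" "c \<in> A" "p \<in> fst c" for p c
  proof -
    note d\<Phi> = has_derivative_gradient[OF smooth_on_differentiable[OF s\<Phi> JB[OF that(1)]]]
    \<comment> \<open>\<open>H\<close> equals \<open>\<Phi> \<circ> J\<close> only on
      \<open>W\<close>; this suffices because the differential is local.\<close>
    have "differential (\<lambda>q. \<Phi> (J q)) c p = differential H c p"
      unfolding differential_def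
    proof (rule frechet_derivative_transform_within_open)
      show "(\<lambda>q. \<Phi> (J q)) \<circ> param c differentiable at (snd c p)"
        by (rule differential_compose(1)[OF dJ param_snd d\<Phi>]) (use that chart in auto)
      show "open (snd c ` (fst c \<inter> W))" by (rule open_chart_image[OF chart[OF that(2)] W(1)])
    qed (use that HJ param_snd[OF chart[OF that(2)]] in auto)
    then have "ham_vf \<Omega> H c p = ham_vf \<Omega> (\<lambda>q. \<Phi> (J q)) c p"
      by (simp add: ham_vf_def)
    also have "\<dots> = P (J p) *\<^sub>R ham_vf \<Omega> (\<lambda>q. J q $ 1) c p + Q (J p) *\<^sub>R ham_vf \<Omega> (\<lambda>q. J q $ 2) c p"
      using ham_vf_compose[OF \<Omega> that(2,3) chart dJ d\<Phi>] that by (simp add: inner_axis P_def Q_def)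
    finally show ?thesis .
  qed
  \<comment> \<open>\<open>U\<close> may contain values of \<open>J\<close> whose fibre is singular or empty; only the invertibility of the
    derivative of \<open>I\<close> is available there, so existence cannot go through \<open>\<tau>\<^sub>1\<close> and \<open>\<tau>\<^sub>2\<close>.\<close>
  have "\<exists>\<omega>. frequency_map A \<Omega> W J H U I \<omega>"
  proof
    \<comment> \<open>The entries solve the triangular system obtained by matching the coefficients
      of the two fields in \<open>X_H\<close> with those in \<open>X_I\<close>.\<close>
    define \<omega> :: "real^2 \<Rightarrow> real^2" where "\<omega> y = (let x = inv_into U I y; w = P x / gradient I1 x $ 1
      in vector [w, Q x - w * gradient I1 x $ 2])" for y
    have "\<omega> (I x) = vector [P x / gradient I1 x $ 1, Q x - P x / gradient I1 x $ 1 * gradient I1 x $ 2]"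
      if "x \<in> U" for x
      using I that by (simp add: \<omega>_def Let_def diffeo_on_def)
    then show "frequency_map A \<Omega> W J H U I \<omega>"
      unfolding frequency_map_def I_nth
      by (simp add: X_H X_I I11 scaleR_diff_left scaleR_add_right)
  qed
  moreover have "\<omega> differentiable (at (I j)) \<and> det (matrix (frechet_derivative \<omega> (at (I j)))) =
      jacobian_formula (tau1 \<sigma>1 j) j (P j) (gradient P j) (gradient Q j) (gradient \<sigma>1 j) (gradient \<sigma>2 j)"
    if \<omega>: "frequency_map A \<Omega> W J H U I \<omega>" for \<omega>
  proof -
    have *: "2 * pi * gradient I1 x $ 1 = tau1 \<sigma>1 x \<and>
        \<omega> (I x) = pair_map (\<lambda>x. 2 * pi * (P x / tau1 \<sigma>1 x)) (\<lambda>x. Q x - P x / tau1 \<sigma>1 x * tau2 \<sigma>2 lg x) x"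
      if x: "x \<in> T" "x \<in> U" for x
    proof -
      obtain p where p: "p \<in> W" "J p = x" "regular_at A J p" using T(5)[OF x(1)] by blast
      have "p \<in> (\<Union>c\<in>A. fst c)" using M W(2) p(1) unfolding smooth_structure_def by blast
      then obtain c where c: "c \<in> A" "p \<in> fst c" by blast
      note indep = ham_vf_independent[OF \<Omega> c chart[OF c(1)] dJ[OF c p(1)] p(3)]
      \<comment> \<open>Comparing \<open>X_I1\<close> with \<open>X_I\<close> recovers the
        derivatives of the action from the relation between vector fields.\<close>
      have \<tau>: "2 * pi * gradient I1 x $ 1 = tau1 \<sigma>1 x \<and> 2 * pi * gradient I1 x $ 2 = tau2 \<sigma>2 lg x"
      proof (rule indep)
        have "(2 * pi) *\<^sub>R ham_vf \<Omega> (\<lambda>q. I1 (J q)) c p = tau1 \<sigma>1 x *\<^sub>R ham_vf \<Omega> (\<lambda>q. J q $ 1) c p +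
            tau2 \<sigma>2 lg x *\<^sub>R ham_vf \<Omega> (\<lambda>q. J q $ 2) c p"
          using X_I1[OF p(1) _ c] x p(2) by simp
        then show "(2 * pi * gradient I1 x $ 1) *\<^sub>R ham_vf \<Omega> (\<lambda>q. J q $ 1) c p +
            (2 * pi * gradient I1 x $ 2) *\<^sub>R ham_vf \<Omega> (\<lambda>q. J q $ 2) c p =
            tau1 \<sigma>1 x *\<^sub>R ham_vf \<Omega> (\<lambda>q. J q $ 1) c p +
            tau2 \<sigma>2 lg x *\<^sub>R ham_vf \<Omega> (\<lambda>q. J q $ 2) c p"
          using X_I[OF p(1) _ c] x p(2) by (simp add: scaleR_add_right)
      qed
      have PQ: "P x = \<omega> (I x) $ 1 * gradient I1 x $ 1 \<and>
          Q x = \<omega> (I x) $ 1 * gradient I1 x $ 2 + \<omega> (I x) $ 2"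
      proof (rule indep)
        have "ham_vf \<Omega> H c p = (\<omega> (I (J p)) $ 1) *\<^sub>R ham_vf \<Omega> (\<lambda>q. I1 (J q)) c p +
            (\<omega> (I (J p)) $ 2) *\<^sub>R ham_vf \<Omega> (\<lambda>q. J q $ 2) c p"
          using \<omega> p x c unfolding frequency_map_def I_nth by blast
        then show "P x *\<^sub>R ham_vf \<Omega> (\<lambda>q. J q $ 1) c p + Q x *\<^sub>R ham_vf \<Omega> (\<lambda>q. J q $ 2) c p =
            (\<omega> (I x) $ 1 * gradient I1 x $ 1) *\<^sub>R ham_vf \<Omega> (\<lambda>q. J q $ 1) c p +
            (\<omega> (I x) $ 1 * gradient I1 x $ 2 + \<omega> (I x) $ 2) *\<^sub>R ham_vf \<Omega> (\<lambda>q. J q $ 2) c p"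
          using X_H[OF p(1) c] X_I[OF p(1) _ c] x p(2)
          by (simp add: scaleR_add_right scaleR_add_left add.assoc)
      qed
      have "P x / tau1 \<sigma>1 x = \<omega> (I x) $ 1 / (2 * pi)"
        using \<tau>[THEN conjunct1, symmetric] PQ I11[OF x(2)] by (simp add: field_simps)
      moreover have "\<omega> (I x) $ 1 / (2 * pi) * tau2 \<sigma>2 lg x = \<omega> (I x) $ 1 * gradient I1 x $ 2"
        using \<tau>[THEN conjunct2, symmetric] by simp
      ultimately have "\<omega> (I x) $ 1 = 2 * pi * (P x / tau1 \<sigma>1 x)"
        "\<omega> (I x) $ 2 = Q x - P x / tau1 \<sigma>1 x * tau2 \<sigma>2 lg x"
        using PQ by simp_all
      with \<tau> show ?thesis
        by (simp add: pair_map_def vec_eq_iff forall_2)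
    qed
    have \<tau>0: "tau1 \<sigma>1 j \<noteq> 0" and j0: "j \<noteq> 0" using T by auto
    have jB: "j \<in> B" using T(5)[OF T(3)] JB by auto
    note d\<tau>1 = has_derivative_tau1[OF has_derivative_gradient[OF \<sigma>(1)] j0]
    note d\<tau>2 = has_derivative_tau2[OF has_derivative_gradient[OF \<sigma>(2)] j0 oU U(1) lg]
    note dP = has_derivative_gradient[OF smooth_on_differentiable[OF sP jB]]
    note dQ = has_derivative_gradient[OF smooth_on_differentiable[OF sQ jB]]
    \<comment> \<open>The quotient \<open>P / tau1\<close> occurs in both frequencies, so its
      derivative is computed once.\<close>
    define g' where "g' h = (gradient P j \<bullet> h) / tau1 \<sigma>1 j -
      P j * (gradient \<sigma>1 j \<bullet> h - (j \<bullet> h) / (norm j)\<^sup>2) / (tau1 \<sigma>1 j)\<^sup>2" for h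
    have dg: "((\<lambda>x. P x / tau1 \<sigma>1 x) has_derivative g') (at j)"
      by (rule has_derivative_eq_rhs[OF has_derivative_divide'[OF dP d\<tau>1 \<tau>0]])
         (use \<tau>0 in \<open>simp add: g'_def fun_eq_iff diff_divide_distrib power2_eq_square\<close>)
    note dG1 = has_derivative_mult_right[OF dg, of "2 * pi"]
    note dG2 = has_derivative_diff[OF dQ has_derivative_mult[OF dg d\<tau>2]]
    obtain G' where G: "(pair_map (\<lambda>x. 2 * pi * (P x / tau1 \<sigma>1 x)) (\<lambda>x. Q x - P x / tau1 \<sigma>1 x * tau2 \<sigma>2 lg x)
        has_derivative G') (at j)"
      using has_derivative_pair_map[OF dG1 dG2] by blast
    have TU: "open (T \<inter> U)" "j \<in> T \<inter> U" using T oU U by auto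
    have \<omega>G: "\<omega> (I x) = pair_map (\<lambda>x. 2 * pi * (P x / tau1 \<sigma>1 x)) (\<lambda>x. Q x - P x / tau1 \<sigma>1 x * tau2 \<sigma>2 lg x) x"
      if "x \<in> T \<inter> U" for x
      using * that by blast
    note jac = diffeo_on_jacobian[OF I U(1) G TU \<omega>G]
    have g'1: "g' (axis i 1) = gradient P j $ i / tau1 \<sigma>1 j -
      P j * (gradient \<sigma>1 j $ i - j $ i / (norm j)\<^sup>2) / (tau1 \<sigma>1 j)\<^sup>2" for i
      by (simp add: g'_def inner_axis)
    \<comment> \<open>\<open>zeta\<close> sends the axis vectors to 1 and the imaginary
      unit.\<close>
    have z: "Im (zeta (axis 1 1) / zeta j) = - j$2 / (norm j)\<^sup>2"
        "Im (zeta (axis 2 1) / zeta j) = j$1 / (norm j)\<^sup>2"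
      by (simp_all add: zeta_def axis_def Im_divide norm_vec2_squared)
    \<comment> \<open>The part of the second row carrying an undifferentiated \<open>tau2\<close> is
      a multiple of the first row and drops out.\<close>
    have "det (matrix G') = 2 * pi *
       (g' (axis 1 1) * (gradient Q j $ 2 - P j / tau1 \<sigma>1 j * (gradient \<sigma>2 j $ 2 + j$1 / (norm j)\<^sup>2)) -
        g' (axis 2 1) * (gradient Q j $ 1 - P j / tau1 \<sigma>1 j * (gradient \<sigma>2 j $ 1 - j$2 / (norm j)\<^sup>2)))"
      unfolding frechet_derivative_at[OF G] det_pair_map[OF dG1 dG2] z
      by (simp add: inner_axis algebra_simps)
    \<comment> \<open>This is the determinant of the derivative of \<open>I\<close>; dividing by it
      yields the prefactor of \<open>jacobian_formula\<close>.\<close>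
    moreover have "gradient I1 j $ 1 = tau1 \<sigma>1 j / (2 * pi)"
      using * T(3) U(1) by (simp add: field_simps)
    ultimately have "det (matrix (frechet_derivative \<omega> (at (I j)))) * (tau1 \<sigma>1 j / (2 * pi)) = 2 * pi *
       (g' (axis 1 1) * (gradient Q j $ 2 - P j / tau1 \<sigma>1 j * (gradient \<sigma>2 j $ 2 + j$1 / (norm j)\<^sup>2)) -
        g' (axis 2 1) * (gradient Q j $ 1 - P j / tau1 \<sigma>1 j * (gradient \<sigma>2 j $ 1 - j$2 / (norm j)\<^sup>2)))"
      using jac(2) det_I[OF U(1)] by simp
    then have "det (matrix (frechet_derivative \<omega> (at (I j)))) = (2 * pi)\<^sup>2 / tau1 \<sigma>1 j *
       (g' (axis 1 1) * (gradient Q j $ 2 - P j / tau1 \<sigma>1 j * (gradient \<sigma>2 j $ 2 + j$1 / (norm j)\<^sup>2)) -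
        g' (axis 2 1) * (gradient Q j $ 1 - P j / tau1 \<sigma>1 j * (gradient \<sigma>2 j $ 1 - j$2 / (norm j)\<^sup>2)))"
      using \<tau>0 by (simp add: field_simps power2_eq_square)
    then have "det (matrix (frechet_derivative \<omega> (at (I j)))) =
        jacobian_formula (tau1 \<sigma>1 j) j (P j) (gradient P j) (gradient Q j) (gradient \<sigma>1 j) (gradient \<sigma>2 j)"
      unfolding jacobian_formula_def g'1 .
    with jac(1) show ?thesis by blast
  qed
  ultimately show ?thesis
    unfolding frequency_jacobian_def I_def by blast
qed

section \<open>The asymptotic expansion\<close>

text \<open>Stated for all large \<open>K\<close>, so that several bounds can be merged into one
  common constant by conjunction.\<close>

lemma eventually_norm_bound:
  assumes "isCont f (x::'a::t2_space)"
  shows "\<forall>\<^sub>F K in at_top. \<forall>\<^sub>F y in at x. norm (f y) \<le> K"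
  using eventually_gt_at_top[of "norm (f x)"]
proof eventually_elim
  case (elim K)
  have "\<forall>\<^sub>F y in at x. norm (f y) < K"
    using tendsto_norm[OF assms[unfolded isCont_def]] elim by (rule order_tendstoD(2))
  then show ?case by (rule eventually_mono) simp
qed

text \<open>Differentiability of \<open>P\<close> at 0 gives the factor \<open>norm j\<close> that
  \<open>jacobian_formula_error\<close> asks for. For the nonvanishing, the error bound divided by
  the leading term is a constant times \<open>tau1 * norm j\<close>, which tends to 0.\<close>

lemma jacobian_formula_asymptotics:
  fixes P \<sigma> :: "real^2 \<Rightarrow> real" and dP dQ a b :: "real^2 \<Rightarrow> real^2"
  assumes cont: "isCont \<sigma> 0" "isCont dP 0" "isCont dQ 0" "isCont a 0" "isCont b 0"
    and P: "P differentiable (at 0)" and nz: "P 0 \<noteq> 0"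
  defines "jac \<equiv> \<lambda>j. jacobian_formula (tau1 \<sigma> j) j (P j) (dP j) (dQ j) (a j) (b j)"
  shows "(\<lambda>j. jac j - (- ((2 * pi * P 0 / (norm j * (tau1 \<sigma> j)\<^sup>2))\<^sup>2)))
       \<in> O[at 0](\<lambda>j. 1 / (norm j * (tau1 \<sigma> j)^3))" (is ?O)
    and "\<forall>\<^sub>F j in at 0. jac j \<noteq> 0"
proof -
  have P2: "(\<lambda>j. (P j)\<^sup>2) differentiable (at 0)"
    using differentiable_power[OF P] by blast
  obtain C where C: "\<forall>\<^sub>F j in at 0. \<bar>(P j)\<^sup>2 - (P 0)\<^sup>2\<bar> \<le> C * norm j"
  proof -
    obtain D where D: "((\<lambda>j. (P j)\<^sup>2) has_derivative D) (at 0)"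
      using P2 unfolding differentiable_def by blast
    \<comment> \<open>Differentiability is used with tolerance 1; this accounts for the 1 in the
      final constant \<open>C + 1\<close>, where \<open>C\<close> bounds the linear part.\<close>
    have "\<exists>e>0. \<forall>j. norm (j - 0) < e \<longrightarrow> norm ((P j)\<^sup>2 - (P 0)\<^sup>2 - D (j - 0)) \<le> 1 * norm (j - 0)"
      using D[unfolded has_derivative_at_alt] zero_less_one by (elim conjE allE[of _ 1]) simp
    then obtain e where e: "e > 0" "\<And>j. norm j < e \<Longrightarrow> norm ((P j)\<^sup>2 - (P 0)\<^sup>2 - D j) \<le> norm j"
      by auto
    obtain C where "\<forall>j. norm (D j) \<le> norm j * C"
      using bounded_linear.bounded[OF has_derivative_bounded_linear[OF D]] by blast
    then have C: "norm (D j) \<le> C * norm j" for j by (simp add: mult.commute)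
    have "\<bar>(P j)\<^sup>2 - (P 0)\<^sup>2\<bar> \<le> (C + 1) * norm j" if "norm j < e" for j
      using e(2)[OF that] C[of j] unfolding real_norm_def distrib_right by linarith
    then have "\<forall>\<^sub>F j in at 0. \<bar>(P j)\<^sup>2 - (P 0)\<^sup>2\<bar> \<le> (C + 1) * norm j"
      unfolding eventually_at using e(1) by (auto intro!: exI[of _ e])
    then show thesis by (rule that)
  qed
  have "\<forall>\<^sub>F K in at_top. (\<forall>\<^sub>F j in at 0. norm (dP j) \<le> K) \<and> (\<forall>\<^sub>F j in at 0. norm (dQ j) \<le> K) \<and>
      (\<forall>\<^sub>F j in at 0. norm (a j) \<le> K) \<and> (\<forall>\<^sub>F j in at 0. norm (b j) \<le> K) \<and>
      (\<forall>\<^sub>F j in at 0. norm (P j) \<le> K) \<and> C \<le> K \<and> 1 \<le> K"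
    by (intro eventually_conj eventually_norm_bound cont differentiable_imp_continuous_within P
        eventually_ge_at_top)
  then obtain K where K: "\<forall>\<^sub>F j in at 0. norm (dP j) \<le> K" "\<forall>\<^sub>F j in at 0. norm (dQ j) \<le> K"
    "\<forall>\<^sub>F j in at 0. norm (a j) \<le> K" "\<forall>\<^sub>F j in at 0. norm (b j) \<le> K"
    "\<forall>\<^sub>F j in at 0. norm (P j) \<le> K" and K_ge: "C \<le> K" "1 \<le> K"
    using eventually_happens'[OF trivial_limit_at_top_linorder] by blast
  note lim = tau1_mult_norm_tendsto_0[OF cont(1)]
  have \<tau>: "\<forall>\<^sub>F j in at 0. 1 \<le> tau1 \<sigma> j"
    using tau1_at_top[OF cont(1)] by (simp add: filterlim_at_top)
  have ne: "\<forall>\<^sub>F j in at (0::real^2). j \<noteq> 0" by (rule eventually_neq_at_within)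
  have small: "\<forall>\<^sub>F j in at 0. tau1 \<sigma> j * norm j < e" if "e > 0" for e
    using order_tendstoD(2)[OF lim that] .
  define E where "E = (2 * pi)\<^sup>2 * (17 * K^4)"
  have "E > 0" using K_ge by (simp add: E_def)
  have err: "\<forall>\<^sub>F j in at 0. \<bar>jac j - (- ((2 * pi * P 0 / (norm j * (tau1 \<sigma> j)\<^sup>2))\<^sup>2))\<bar>
      \<le> E * (1 / (norm j * (tau1 \<sigma> j)^3))"
    using K C \<tau> ne small[OF zero_less_one]
  proof eventually_elim
    case (elim j)
    have "C * norm j \<le> K * norm j" using K_ge by (intro mult_right_mono) auto
    with elim have "\<bar>(P j)\<^sup>2 - (P 0)\<^sup>2\<bar> \<le> K * norm j" by linarith
    then show ?case
      unfolding jac_def E_def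
      using elim K_ge by (intro jacobian_formula_error) auto
  qed
  show ?O
    by (rule bigoI[where c = E]) (use err \<tau> in eventually_elim, simp)
  \<comment> \<open>Once \<open>tau1 * norm j\<close> is below this threshold, the error bound is
    strictly smaller than the leading term.\<close>
  define e where "e = (2 * pi * P 0)\<^sup>2 / E"
  have "e > 0" using \<open>E > 0\<close> nz by (simp add: e_def)
  show "\<forall>\<^sub>F j in at 0. jac j \<noteq> 0"
    using err \<tau> ne small[OF \<open>e > 0\<close>]
  proof eventually_elim
    case (elim j)
    define r t where "r = norm j" "t = tau1 \<sigma> j"
    have rt: "r > 0" "t > 0" using elim by (auto simp: r_t_def)
    have "E * (t * r) < (2 * pi * P 0)\<^sup>2"
      using elim(4) \<open>E > 0\<close> by (simp add: e_def r_t_def field_simps)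
    then have "E * (t * r) / (r\<^sup>2 * t^4) < (2 * pi * P 0)\<^sup>2 / (r\<^sup>2 * t^4)"
      using rt by (intro divide_strict_right_mono) auto
    moreover have "E * (t * r) / (r\<^sup>2 * t^4) = E * (1 / (r * t^3))"
      using rt by (simp add: field_simps power2_eq_square power3_eq_cube power4_eq_xxxx)
    moreover have "(2 * pi * P 0)\<^sup>2 / (r\<^sup>2 * t^4) = (2 * pi * P 0 / (r * t\<^sup>2))\<^sup>2"
      by (simp add: power_divide power_mult_distrib flip: power_mult)
    ultimately have "E * (1 / (r * t^3)) < (2 * pi * P 0 / (r * t\<^sup>2))\<^sup>2" by simp
    with elim(1) show ?case by (auto simp: r_t_def)
  qed
qed

theorem theorem5:
  fixes M :: "'m::{t2_space,second_countable_topology} set"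
    and A :: "'m chart set" and \<Omega> :: "'m two_form"
    and H L :: "'m \<Rightarrow> real" and m :: 'm and c0 :: "'m chart"
    and \<alpha> \<omega> :: real
    and B :: "(real^2) set" and \<Phi> \<Psi> :: "real^2 \<Rightarrow> real"
    and S W :: "'m set" and J :: "'m \<Rightarrow> real^2"
    and \<sigma>1 \<sigma>2 :: "real^2 \<Rightarrow> real"
  assumes manifold: "smooth_structure M A"
    and symplectic: "symplectic_form A \<Omega>"
    and smooth_H: "smooth_function A M H"
    and smooth_L: "smooth_function A M L"
    and commute: "commuting A \<Omega> H L"
    and regular: "regular_ae A (pair_map H L)"
    and m: "m \<in> M" "pair_map H L m = 0"
    and equilibrium: "\<forall>c\<in>A. m \<in> fst c \<longrightarrow> ham_vf \<Omega> H c m = 0"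
    and nonzero: "\<alpha> \<noteq> 0" "\<omega> \<noteq> 0"
    and eigenvalues: "\<forall>c\<in>A. m \<in> fst c \<longrightarrow>
          {z. is_eigenvalue (frechet_derivative (\<lambda>x. ham_vf \<Omega> H c (param c x)) (at (snd c m))) z} =
          {Complex \<alpha> \<omega>, Complex \<alpha> (-\<omega>), Complex (-\<alpha>) \<omega>, Complex (-\<alpha>) (-\<omega>)}"
    and S: "S = connected_component_set {p\<in>M. pair_map H L p = 0} m"
    and S_compact: "compact S"
    and S_regular: "\<forall>p\<in>S. p \<noteq> m \<longrightarrow> regular_at A (pair_map H L) p"
    and diffeo: "0 \<in> B" "diffeo_on B (pair_map \<Phi> \<Psi>)"
    and \<Phi>: "\<Phi> 0 = 0" "frechet_derivative \<Phi> (at 0) (axis 1 1) = \<alpha>"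
            "frechet_derivative \<Phi> (at 0) (axis 2 1) = \<omega>"
    and normal_form: "c0 \<in> A" "m \<in> fst c0" "snd c0 m = 0"
          "\<forall>x\<in>snd c0 ` fst c0. \<Omega> c0 x = std_form"
          "\<forall>x\<in>snd c0 ` fst c0. std_momentum x \<in> B \<and>
             H (param c0 x) = \<Phi> (std_momentum x) \<and> L (param c0 x) = \<Psi> (std_momentum x)"
    and W: "open W" "S \<subseteq> W" "W \<subseteq> M"
    and J: "\<forall>p\<in>W. pair_map H L p \<in> pair_map \<Phi> \<Psi> ` B \<and>
             J p = inv_into B (pair_map \<Phi> \<Psi>) (pair_map H L p)"
    and tori: "\<forall>\<^sub>F j in at 0.
          {p\<in>W. J p = j} homeomorphic (sphere (0::complex) 1 \<times> sphere (0::complex) 1) \<and>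
          (\<forall>p\<in>W. J p = j \<longrightarrow> regular_at A J p)"
    and J2_periodic: "\<forall>p\<in>W. \<exists>\<gamma>. integral_curve A \<Omega> W (\<lambda>q. J q $ 2) \<gamma> \<and> \<gamma> 0 = p \<and>
          (\<forall>t. \<gamma> (t + 2 * pi) = \<gamma> t)"
    and \<sigma>_smooth: "\<exists>N. open N \<and> 0 \<in> N \<and> smooth_on N \<sigma>1 \<and> smooth_on N \<sigma>2"
    and first_actions: "\<forall>\<^sub>F j in at 0. \<exists>U lg I1. j \<in> U \<and> first_action A \<Omega> W J \<sigma>1 \<sigma>2 U lg I1"
  shows "\<exists>jac :: real^2 \<Rightarrow> real.
    (\<forall>\<^sub>F j in at 0. \<forall>U lg I1. j \<in> U \<and> first_action A \<Omega> W J \<sigma>1 \<sigma>2 U lg I1 \<longrightarrow>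
       frequency_jacobian A \<Omega> W J H U (pair_map I1 (\<lambda>j. j$2)) j (jac j)) \<and>
    (\<lambda>j. jac j - (- ((2 * pi * \<alpha> / (norm j * (tau1 \<sigma>1 j)^2))^2)))
       \<in> O[at 0](\<lambda>j. 1 / (norm j * (tau1 \<sigma>1 j)^3)) \<and>
    tau1 \<sigma>1 \<in> \<Theta>[at 0](\<lambda>j. ln (norm j)) \<and>
    (\<forall>\<^sub>F j in at 0. jac j \<noteq> 0)"
proof -
  define P where "P = (\<lambda>x. gradient \<Phi> x $ 1)"
  define Q where "Q = (\<lambda>x. gradient \<Phi> x $ 2)"
  \<comment> \<open>The formula involves neither \<open>U\<close> nor \<open>lg\<close> nor
    \<open>I1\<close>, so one function serves all local choices of action.\<close>
  define jac where "jac j = jacobian_formula (tau1 \<sigma>1 j) j (P j) (gradient P j) (gradient Q j)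
    (gradient \<sigma>1 j) (gradient \<sigma>2 j)" for j
  obtain N where N: "open N" "0 \<in> N" "smooth_on N \<sigma>1" "smooth_on N \<sigma>2"
    using \<sigma>_smooth by blast
  have sB: "open B" "smooth_on B (pair_map \<Phi> \<Psi>)" using diffeo by (auto simp: diffeo_on_def)
  have s\<Phi>: "smooth_on B \<Phi>"
    using smooth_on_vec_nth[OF sB, of 1] by (simp add: pair_map_def)
  have sP: "smooth_on B P" and sQ: "smooth_on B Q"
    using smooth_on_frechet_derivative[OF s\<Phi>] by (simp_all add: P_def Q_def gradient_def)
  have P0: "P 0 = \<alpha>" using \<Phi> by (simp add: P_def gradient_def)
  have c\<sigma>: "isCont \<sigma>1 0"
    using smooth_on_continuous[OF N(3)] N by (simp add: continuous_on_eq_continuous_at)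
  note asymp = jacobian_formula_asymptotics[OF c\<sigma> isCont_gradient[OF sB(1) diffeo(1) sP]
      isCont_gradient[OF sB(1) diffeo(1) sQ] isCont_gradient[OF N(1,2,3)] isCont_gradient[OF N(1,2,4)]
      smooth_on_differentiable[OF sP diffeo(1)], folded jac_def, unfolded P0, OF nonzero(1)]
  have "\<forall>\<^sub>F j in at 0. 1 \<le> tau1 \<sigma>1 j"
    using tau1_at_top[OF c\<sigma>] by (simp add: filterlim_at_top)
  moreover have "\<forall>\<^sub>F j in at 0. j \<in> N"
    using N by (auto simp: eventually_at_topological)
  ultimately have "\<forall>\<^sub>F j in at 0. j \<in> N \<and> tau1 \<sigma>1 j \<noteq> 0 \<and> (\<exists>p\<in>W. J p = j \<and> regular_at A J p)"
    using tori
  proof eventually_elim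
    case (elim j)
    \<comment> \<open>The torus is nonempty, hence so is the fibre, and its points are regular by
      \<open>tori\<close>.\<close>
    have "1 \<in> sphere (0::complex) 1" by simp
    then have "sphere (0::complex) 1 \<times> sphere (0::complex) 1 \<noteq> {}" by blast
    moreover have "X \<noteq> {}" if "X homeomorphic Y" "Y \<noteq> {}" for X :: "'m set" and Y :: "(complex \<times> complex) set"
      using that homeomorphic_empty(1)[of Y] by blast
    ultimately have "{p\<in>W. J p = j} \<noteq> {}" using elim(3) by blast
    with elim show ?case by auto
  qed
  \<comment> \<open>The open set \<open>V - {0}\<close> plays the role of \<open>T\<close> in
    \<open>frequency_jacobian_eq\<close>, simultaneously for all of its points
    \<open>j\<close>.\<close>
  then obtain V where V: "open V" "0 \<in> V"
    and reg: "\<And>j. j \<in> V - {0} \<Longrightarrow> j \<in> N \<and> tau1 \<sigma>1 j \<noteq> 0 \<and> (\<exists>p\<in>W. J p = j \<and> regular_at A J p)"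
    unfolding eventually_at_topological by blast
  have "\<forall>\<^sub>F j in at 0. j \<in> V - {0}"
    using V by (auto simp: eventually_at_topological)
  then have "\<forall>\<^sub>F j in at 0. \<forall>U lg I1. j \<in> U \<and> first_action A \<Omega> W J \<sigma>1 \<sigma>2 U lg I1 \<longrightarrow>
       frequency_jacobian A \<Omega> W J H U (pair_map I1 (\<lambda>j. j$2)) j (jac j)"
  proof eventually_elim
    case (elim j)
    show ?case
    proof (intro allI impI, elim conjE)
      fix U lg I1 assume U: "j \<in> U" "first_action A \<Omega> W J \<sigma>1 \<sigma>2 U lg I1"
      show "frequency_jacobian A \<Omega> W J H U (pair_map I1 (\<lambda>j. j$2)) j (jac j)"
        unfolding jac_def P_def Q_def
        using V reg elim N
        by (intro frequency_jacobian_eq[OF manifold symplectic smooth_H smooth_L diffeo(2) W(1,3) J _ _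
              _ _ elim _ _ U]) (auto intro: smooth_on_differentiable)
    qed
  qed
  with asymp tau1_bigtheta[OF c\<sigma>] show ?thesis by blast
qed

end
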